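(* Let $p>3$ be a prime, $\zeta$ a primitive $p$-th root of unity, $K=\mathbb{Q}(\zeta)$, $g=\mathrm{Gal}(K/\mathbb{Q})$ and $Y$ an indeterminate. Consider the multiplicative $\mathbb{Z}_p[g]$-module $\mathcal M=\mathbb{Z}_p\otimes_{\mathbb{Z}}K(Y)^\times$ and the idempotent $\varepsilon_\omega=\frac1{p-1}\sum_{s\in g}\omega^{-1}(s)\,s\in\mathbb{Z}_p[g]$. Then there does not exist any automorphism $T$ of the field $\mathbb{Q}(Y)$, distinct from the identity and from the inversion $Y\mapsto Y^{-1}$, such that, with $T(1+Y\zeta):=1+T(Y)\zeta$, $$\big(1+T(Y)\zeta\big)^{\varepsilon_\omega}=\big(1+Y\zeta^\lambda\big)^{\varepsilon_\omega}\,\zeta^\mu$$ up to a $p$-th power in $\mathcal M$, for some $\lambda,\mu\in\mathbb{Z}$ with $\lambda\not\equiv0\pmod p$.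
   Context: $g$ acts on $K(Y)$ through the coefficients (fixing $Y$). $\omega: g\to\mu_{p-1}(\mathbb{Q}_p)$ is the Teichmüller character: if $s_k(\zeta)=\zeta^k$, then $\omega(s_k)$ is the $(p-1)$-th root of unity in $\mathbb{Q}_p$ congruent to $k$ modulo $p$. *)

theory Defs
  imports
    "HOL-Algebra.Free_Abelian_Groups"
    "HOL-Algebra.Ring"
    "HOL-Computational_Algebra.Polynomial"
    "HOL-Computational_Algebra.Fraction_Field"
begin

section \<open>Fields and rational functions\<close>

definition field_aut :: "('a::field \<Rightarrow> 'a) \<Rightarrow> bool" where
  "field_aut s \<longleftrightarrow> bij s \<and> s 1 = 1 \<and> (\<forall>x y. s (x + y) = s x + s y) \<and> (\<forall>x y. s (x * y) = s x * s y)"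

definition is_subfield :: "'a::field set \<Rightarrow> bool" where
  "is_subfield F \<longleftrightarrow> 0 \<in> F \<and> 1 \<in> F \<and> (\<forall>x\<in>F. - x \<in> F \<and> inverse x \<in> F)
     \<and> (\<forall>x\<in>F. \<forall>y\<in>F. x + y \<in> F \<and> x * y \<in> F)"

text \<open>In characteristic 0 every subfield contains the rationals, so this is the field obtained by
  adjoining \<open>z\<close> to the rationals.\<close>

definition rat_adjoin :: "'a::field_char_0 \<Rightarrow> 'a set" where
  "rat_adjoin z = \<Inter> {F. is_subfield F \<and> z \<in> F}"

definition primitive_root_of_unity :: "nat \<Rightarrow> 'a::field \<Rightarrow> bool" where
  "primitive_root_of_unity n z \<longleftrightarrow> z ^ n = 1 \<and> (\<forall>k. 0 < k \<and> k < n \<longrightarrow> z ^ k \<noteq> 1)"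

text \<open>The Galois group over the rationals of the field formed by the whole type.\<close>

definition galQ :: "('k::field_char_0 \<Rightarrow> 'k) set" where
  "galQ = {s. field_aut s \<and> (\<forall>q. s (of_rat q) = of_rat q)}"

type_synonym 'k ratfun = "'k poly fract"

definition ratfun_var :: "'k::field ratfun" where
  "ratfun_var = Fract [:0, 1:] 1"

definition ratfun_const :: "'k::field \<Rightarrow> 'k ratfun" where
  "ratfun_const c = Fract [:c:] 1"

text \<open>Application of a field homomorphism \<open>h\<close> to the coefficients, fixing the variable.\<close>

definition ratfun_map :: "('a::field \<Rightarrow> 'b::field) \<Rightarrow> 'a ratfun \<Rightarrow> 'b ratfun" where
  "ratfun_map h r =
     (THE q. \<exists>a b. b \<noteq> 0 \<and> r = Fract a b \<and> q = Fract (map_poly h a) (map_poly h b))"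

lemma map_poly_hom_mult:
  fixes h :: "'a::field \<Rightarrow> 'b::field"
  assumes "h 0 = 0" "\<And>x y. h (x + y) = h x + h y" "\<And>x y. h (x * y) = h x * h y"
  shows "map_poly h (a * b) = map_poly h a * map_poly h b"
proof -
  have hsum: "h (sum f A) = (\<Sum>i\<in>A. h (f i))" for f :: "nat \<Rightarrow> 'a" and A
    by (induction A rule: infinite_finite_induct) (auto simp: assms)
  show ?thesis
    by (rule poly_eqI) (simp add: coeff_map_poly coeff_mult hsum assms)
qed

lemma ratfun_map_Fract:
  fixes h :: "'a::field \<Rightarrow> 'b::field"
  assumes one: "h 1 = 1" and add: "\<And>x y. h (x + y) = h x + h y"
    and mult: "\<And>x y. h (x * y) = h x * h y" and b: "b \<noteq> 0"
  shows "ratfun_map h (Fract a b) = Fract (map_poly h a) (map_poly h b)"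
proof -
  have zero: "h 0 = 0" by (metis add add_cancel_right_right add_0)
  have nz: "h x \<noteq> 0" if "x \<noteq> 0" for x
    using mult[of x "inverse x"] that one by auto
  have map_nz: "map_poly h c \<noteq> 0" if "c \<noteq> 0" for c
    using that nz zero by (subst map_poly_eq_0_iff) auto
  note hm = map_poly_hom_mult[of h, OF zero add mult]
  show ?thesis
    unfolding ratfun_map_def
  proof (rule the_equality)
    show "\<exists>a' b'. b' \<noteq> 0 \<and> Fract a b = Fract a' b'
        \<and> Fract (map_poly h a) (map_poly h b) = Fract (map_poly h a') (map_poly h b')"
      using b by blast
  next
    fix q
    assume "\<exists>a' b'. b' \<noteq> 0 \<and> Fract a b = Fract a' b' \<and> q = Fract (map_poly h a') (map_poly h b')"
    then obtain a' b' where *: "b' \<noteq> 0" "Fract a b = Fract a' b'"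
      "q = Fract (map_poly h a') (map_poly h b')" by blast
    then have "a * b' = a' * b" using b by (simp add: eq_fract)
    then have "map_poly h a * map_poly h b' = map_poly h a' * map_poly h b"
      by (metis hm)
    then show "q = Fract (map_poly h a) (map_poly h b)"
      using * b map_nz by (simp add: eq_fract)
  qed
qed

definition ratfun_units :: "'k::field ratfun monoid" where
  "ratfun_units = \<lparr>carrier = UNIV - {0}, monoid.mult = (*), one = 1\<rparr>"


section \<open>Tensor product of abelian groups\<close>

definition tensor_rel :: "('a, 'm) monoid_scheme \<Rightarrow> ('b, 'n) monoid_scheme \<Rightarrow> ('a \<times> 'b \<Rightarrow>\<^sub>0 int) set" where
  "tensor_rel A B = generate (free_Abelian_group (carrier A \<times> carrier B))
     ({frag_of (a \<otimes>\<^bsub>A\<^esub> a', b) - frag_of (a, b) - frag_of (a', b) | a a' b.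
         a \<in> carrier A \<and> a' \<in> carrier A \<and> b \<in> carrier B}
      \<union> {frag_of (a, b \<otimes>\<^bsub>B\<^esub> b') - frag_of (a, b) - frag_of (a, b') | a b b'.
         a \<in> carrier A \<and> b \<in> carrier B \<and> b' \<in> carrier B})"

definition tensor_group :: "('a, 'm) monoid_scheme \<Rightarrow> ('b, 'n) monoid_scheme \<Rightarrow> ('a \<times> 'b \<Rightarrow>\<^sub>0 int) set monoid" where
  "tensor_group A B = free_Abelian_group (carrier A \<times> carrier B) Mod tensor_rel A B"

definition pure_tensor :: "('a, 'm) monoid_scheme \<Rightarrow> ('b, 'n) monoid_scheme \<Rightarrow> 'a \<Rightarrow> 'b \<Rightarrow> ('a \<times> 'b \<Rightarrow>\<^sub>0 int) set" where
  "pure_tensor A B a b =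
     tensor_rel A B #>\<^bsub>free_Abelian_group (carrier A \<times> carrier B)\<^esub> frag_of (a, b)"

text \<open>The map \<open>a \<otimes> b \<mapsto> f a \<otimes> h b\<close>. For homomorphisms \<open>f\<close> and \<open>h\<close> all cosets in the union
  coincide.\<close>

definition tensor_map ::
    "('c, 'm) monoid_scheme \<Rightarrow> ('d, 'n) monoid_scheme \<Rightarrow> ('a \<Rightarrow> 'c) \<Rightarrow> ('b \<Rightarrow> 'd)
     \<Rightarrow> ('a \<times> 'b \<Rightarrow>\<^sub>0 int) set \<Rightarrow> ('c \<times> 'd \<Rightarrow>\<^sub>0 int) set" where
  "tensor_map C D f h X =
     (\<Union>x\<in>X. tensor_rel C D #>\<^bsub>free_Abelian_group (carrier C \<times> carrier D)\<^esub>
               frag_extend (\<lambda>(a, b). frag_of (f a, h b)) x)"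

lemma tensor_rel_subgroup:
  assumes "group A" "group B"
  shows "subgroup (tensor_rel A B) (free_Abelian_group (carrier A \<times> carrier B))"
  unfolding tensor_rel_def
proof (rule group.generate_is_subgroup)
  interpret A: group A by fact
  interpret B: group B by fact
  show "group (free_Abelian_group (carrier A \<times> carrier B))" by simp
  show "{frag_of (a \<otimes>\<^bsub>A\<^esub> a', b) - frag_of (a, b) - frag_of (a', b) | a a' b.
         a \<in> carrier A \<and> a' \<in> carrier A \<and> b \<in> carrier B}
      \<union> {frag_of (a, b \<otimes>\<^bsub>B\<^esub> b') - frag_of (a, b) - frag_of (a, b') | a b b'.
         a \<in> carrier A \<and> b \<in> carrier B \<and> b' \<in> carrier B}
      \<subseteq> carrier (free_Abelian_group (carrier A \<times> carrier B))"
    by (auto dest!: subsetD[OF keys_diff])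
qed

lemma comm_group_tensor_group:
  assumes "group A" "group B"
  shows "comm_group (tensor_group A B)"
  unfolding tensor_group_def
  by (intro comm_group.abelian_FactGroup abelian_free_Abelian_group tensor_rel_subgroup assms)

lemma tensor_map_rcoset:
  assumes A: "group A" and B: "group B" and C: "group C" and D: "group D"
    and f: "f \<in> hom A C" and h: "h \<in> hom B D"
    and x: "x \<in> carrier (free_Abelian_group (carrier A \<times> carrier B))"
  shows "tensor_map C D f h (tensor_rel A B #>\<^bsub>free_Abelian_group (carrier A \<times> carrier B)\<^esub> x)
       = tensor_rel C D #>\<^bsub>free_Abelian_group (carrier C \<times> carrier D)\<^esub>
           frag_extend (\<lambda>(a, b). frag_of (f a, h b)) x"
proof -
  let ?F = "free_Abelian_group (carrier A \<times> carrier B)"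
  let ?G = "free_Abelian_group (carrier C \<times> carrier D)"
  let ?e = "frag_extend (\<lambda>(a, b). frag_of (f a, h b))"
  let ?R = "{frag_of (a \<otimes>\<^bsub>A\<^esub> a', b) - frag_of (a, b) - frag_of (a', b) | a a' b.
         a \<in> carrier A \<and> a' \<in> carrier A \<and> b \<in> carrier B}
      \<union> {frag_of (a, b \<otimes>\<^bsub>B\<^esub> b') - frag_of (a, b) - frag_of (a, b') | a b b'.
         a \<in> carrier A \<and> b \<in> carrier B \<and> b' \<in> carrier B}"
  let ?S = "{frag_of (a \<otimes>\<^bsub>C\<^esub> a', b) - frag_of (a, b) - frag_of (a', b) | a a' b.
         a \<in> carrier C \<and> a' \<in> carrier C \<and> b \<in> carrier D}
      \<union> {frag_of (a, b \<otimes>\<^bsub>D\<^esub> b') - frag_of (a, b) - frag_of (a, b') | a b b'.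
         a \<in> carrier C \<and> b \<in> carrier D \<and> b' \<in> carrier D}"
  note sA = tensor_rel_subgroup[OF A B] and sC = tensor_rel_subgroup[OF C D]
  interpret A: group A by fact
  interpret B: group B by fact
  interpret SC: subgroup "tensor_rel C D" ?G by (rule sC)
  interpret SA: subgroup "tensor_rel A B" ?F by (rule sA)
  have gen: "?e r \<in> ?S" if "r \<in> ?R" for r
    using that
  proof (elim UnE CollectE exE conjE)
    fix a a' b
    assume "r = frag_of (a \<otimes>\<^bsub>A\<^esub> a', b) - frag_of (a, b) - frag_of (a', b)"
      "a \<in> carrier A" "a' \<in> carrier A" "b \<in> carrier B"
    then have "?e r = frag_of (f a \<otimes>\<^bsub>C\<^esub> f a', h b) - frag_of (f a, h b) - frag_of (f a', h b)"
      and "f a \<in> carrier C" "f a' \<in> carrier C" "h b \<in> carrier D"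
      using f h by (auto simp: frag_extend_diff hom_mult hom_in_carrier)
    then show ?thesis by (intro UnI1 CollectI exI conjI)
  next
    fix a b b'
    assume "r = frag_of (a, b \<otimes>\<^bsub>B\<^esub> b') - frag_of (a, b) - frag_of (a, b')"
      "a \<in> carrier A" "b \<in> carrier B" "b' \<in> carrier B"
    then have "?e r = frag_of (f a, h b \<otimes>\<^bsub>D\<^esub> h b') - frag_of (f a, h b) - frag_of (f a, h b')"
      and "f a \<in> carrier C" "h b \<in> carrier D" "h b' \<in> carrier D"
      using f h by (auto simp: frag_extend_diff hom_mult hom_in_carrier)
    then show ?thesis by (intro UnI2 CollectI exI conjI)
  qed
  have Rc: "?R \<subseteq> carrier ?F"
    by (auto dest!: subsetD[OF keys_diff])
  have gen_rel: "?e r \<in> tensor_rel C D" if "r \<in> ?R" for r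
    unfolding tensor_rel_def[of C D] by (rule generate.incl, rule gen, rule that)
  have rel: "?e r \<in> tensor_rel C D" if "r \<in> tensor_rel A B" for r
    using that unfolding tensor_rel_def[of A B]
  proof (induction rule: generate.induct)
    case one
    then show ?case using SC.one_closed by simp
  next
    case (incl r)
    show ?case by (rule gen_rel, rule incl)
  next
    case (inv r)
    have "r \<in> carrier ?F" by (rule subsetD[OF Rc], rule inv)
    moreover have m: "?e r \<in> tensor_rel C D"
      by (rule gen_rel, rule inv)
    moreover have "?e r \<in> carrier ?G" using m SC.subset by blast
    ultimately show ?case
      using SC.m_inv_closed[OF m] by (simp add: frag_extend_minus)
  next
    case (eng r s)
    then show ?case using SC.m_closed by (simp add: frag_extend_add)
  qed
  have ec: "?e y \<in> carrier ?G" if "y \<in> carrier ?F" for y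
    using that hom_in_carrier[OF f] hom_in_carrier[OF h]
    by (auto dest!: subsetD[OF keys_frag_extend])
  have coset: "tensor_rel C D #>\<^bsub>?G\<^esub> ?e y = tensor_rel C D #>\<^bsub>?G\<^esub> ?e x"
    if y: "y \<in> tensor_rel A B #>\<^bsub>?F\<^esub> x" for y
  proof -
    obtain r where r: "r \<in> tensor_rel A B" "y = r + x"
      using y unfolding r_coset_def mult_free_Abelian_group by blast
    then have "?e y \<in> tensor_rel C D #>\<^bsub>?G\<^esub> ?e x"
      using rel[of r] unfolding r_coset_def mult_free_Abelian_group r(2) frag_extend_add by blast
    then show ?thesis
      using group.repr_independence[OF _ _ ec[OF x] sC] by simp
  qed
  have "x \<in> tensor_rel A B #>\<^bsub>?F\<^esub> x"
    using group.rcos_self[OF _ x sA] by simp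
  then show ?thesis
    unfolding tensor_map_def using coset by blast
qed

lemma tensor_map_pure:
  assumes "group A" "group B" "group C" "group D" "f \<in> hom A C" "h \<in> hom B D"
    and "a \<in> carrier A" "b \<in> carrier B"
  shows "tensor_map C D f h (pure_tensor A B a b) = pure_tensor C D (f a) (h b)"
  unfolding pure_tensor_def using assms by (subst tensor_map_rcoset) auto


section \<open>The \<open>p\<close>-adic integers\<close>

text \<open>The inverse limit of the rings \<open>\<int>/p\<^sup>n\<close>: an element is the sequence of its residues
  \<open>x n \<in> {0..<p\<^sup>n}\<close>. In particular \<open>x 1\<close> is the residue of \<open>x\<close> modulo \<open>p\<close>.\<close>

definition Zp :: "nat \<Rightarrow> (nat \<Rightarrow> int) ring" where
  "Zp p = \<lparr>carrier = {x. \<forall>n. x n \<in> {0..<int p ^ n} \<and> x (Suc n) mod int p ^ n = x n},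
     monoid.mult = \<lambda>x y n. (x n * y n) mod int p ^ n,
     one = \<lambda>n. 1 mod int p ^ n,
     ring.zero = \<lambda>n. 0,
     ring.add = \<lambda>x y n. (x n + y n) mod int p ^ n\<rparr>"

lemma cring_Zp:
  assumes "p > 0"
  shows "cring (Zp p)"
proof -
  have compat: "f (Suc n) mod int p ^ Suc n mod int p ^ n = f (Suc n) mod int p ^ n" for f n
    by (simp add: mod_mod_cancel)
  have red: "(x (Suc n) * y (Suc n)) mod int p ^ n = (x n * y n) mod int p ^ n"
       "(x (Suc n) + y (Suc n)) mod int p ^ n = (x n + y n) mod int p ^ n"
    if "x \<in> carrier (Zp p)" "y \<in> carrier (Zp p)" for x y n
  proof -
    have "x (Suc n) mod int p ^ n = x n" "y (Suc n) mod int p ^ n = y n"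
      using that by (auto simp: Zp_def)
    then show "(x (Suc n) * y (Suc n)) mod int p ^ n = (x n * y n) mod int p ^ n"
       "(x (Suc n) + y (Suc n)) mod int p ^ n = (x n + y n) mod int p ^ n"
      by (metis mod_mult_eq, metis mod_add_eq)
  qed
  have small: "x n mod int p ^ n = x n" if "x \<in> carrier (Zp p)" for x n
    using that by (auto simp: Zp_def)
  have closed: "(\<lambda>n. f n mod int p ^ n) \<in> carrier (Zp p)"
    if "\<And>n. f (Suc n) mod int p ^ n = f n mod int p ^ n" for f
    using that assms by (auto simp: Zp_def mod_mod_cancel)
  have neg: "\<exists>y\<in>carrier (Zp p). (\<lambda>n. (y n + x n) mod int p ^ n) = (\<lambda>n. 0)"
    if "x \<in> carrier (Zp p)" for x
  proof
    have "x (Suc n) mod int p ^ n = x n" for n using that by (auto simp: Zp_def)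
    then show "(\<lambda>n. (- x n) mod int p ^ n) \<in> carrier (Zp p)"
      by (intro closed) (metis mod_minus_eq)
    show "(\<lambda>n. ((- x n) mod int p ^ n + x n) mod int p ^ n) = (\<lambda>n. 0)"
      by (simp add: mod_simps)
  qed
  show ?thesis
  proof (rule cringI)
    show "abelian_group (Zp p)"
    proof (rule abelian_groupI)
      fix x y assume "x \<in> carrier (Zp p)" "y \<in> carrier (Zp p)"
      then show "x \<oplus>\<^bsub>Zp p\<^esub> y \<in> carrier (Zp p)"
        using closed[of "\<lambda>n. x n + y n"] red by (simp add: Zp_def)
    next
      show "\<zero>\<^bsub>Zp p\<^esub> \<in> carrier (Zp p)" using assms by (auto simp: Zp_def)
    next
      fix x assume "x \<in> carrier (Zp p)"
      then show "\<exists>y\<in>carrier (Zp p). y \<oplus>\<^bsub>Zp p\<^esub> x = \<zero>\<^bsub>Zp p\<^esub>"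
        using neg by (simp add: Zp_def)
    next
      fix x assume "x \<in> carrier (Zp p)"
      then show "\<zero>\<^bsub>Zp p\<^esub> \<oplus>\<^bsub>Zp p\<^esub> x = x"
        using small by (simp add: Zp_def)
    qed (simp_all add: Zp_def mod_simps add.assoc, simp_all add: add.commute)
    show "comm_monoid (Zp p)"
    proof (rule comm_monoidI)
      fix x y assume "x \<in> carrier (Zp p)" "y \<in> carrier (Zp p)"
      then show "x \<otimes>\<^bsub>Zp p\<^esub> y \<in> carrier (Zp p)"
        using closed[of "\<lambda>n. x n * y n"] red by (simp add: Zp_def)
    next
      show "\<one>\<^bsub>Zp p\<^esub> \<in> carrier (Zp p)"
        using closed[of "\<lambda>n. 1"] by (simp add: Zp_def)
    next
      fix x assume "x \<in> carrier (Zp p)"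
      then show "\<one>\<^bsub>Zp p\<^esub> \<otimes>\<^bsub>Zp p\<^esub> x = x"
        using small by (simp add: Zp_def mod_simps)
    qed (simp_all add: Zp_def mod_simps mult.assoc, simp_all add: mult.commute)
  qed (simp add: Zp_def mod_simps distrib_right)
qed

text \<open>For \<open>s \<zeta> = \<zeta>\<^sup>k\<close>, the \<open>(p - 1)\<close>-th root of unity congruent to \<open>k\<close> modulo \<open>p\<close>.\<close>

definition teichmueller_char :: "nat \<Rightarrow> 'k::field_char_0 \<Rightarrow> ('k \<Rightarrow> 'k) \<Rightarrow> nat \<Rightarrow> int" where
  "teichmueller_char p \<zeta> s = (THE x. x \<in> carrier (Zp p) \<and> x [^]\<^bsub>Zp p\<^esub> (p - 1) = \<one>\<^bsub>Zp p\<^esub>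
     \<and> (\<exists>k::nat. s \<zeta> = \<zeta> ^ k \<and> x 1 = int k mod int p))"


section \<open>The \<open>\<int>\<^sub>p[g]\<close>-module \<open>\<int>\<^sub>p \<otimes> K(Y)\<^sup>\<times>\<close>\<close>

abbreviation Mmod :: "nat \<Rightarrow> ((nat \<Rightarrow> int) \<times> 'k::field ratfun \<Rightarrow>\<^sub>0 int) set monoid" where
  "Mmod p \<equiv> tensor_group (add_monoid (Zp p)) ratfun_units"

text \<open>The image \<open>1 \<otimes> r\<close> of \<open>r\<close>.\<close>

abbreviation Memb :: "nat \<Rightarrow> 'k::field ratfun \<Rightarrow> ((nat \<Rightarrow> int) \<times> 'k ratfun \<Rightarrow>\<^sub>0 int) set" where
  "Memb p r \<equiv> pure_tensor (add_monoid (Zp p)) ratfun_units \<one>\<^bsub>Zp p\<^esub> r"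

text \<open>An element \<open>\<Sum>s. \<theta> s \<cdot> s\<close> of the group ring is represented by its coefficient function
  \<open>\<theta>\<close> on \<open>galQ\<close>; it sends \<open>c \<otimes> r\<close> to the product over \<open>s\<close> of \<open>\<theta> s * c \<otimes> s(r)\<close>.\<close>

definition Mexp :: "nat \<Rightarrow> ((nat \<Rightarrow> int) \<times> 'k::field_char_0 ratfun \<Rightarrow>\<^sub>0 int) set
    \<Rightarrow> (('k \<Rightarrow> 'k) \<Rightarrow> nat \<Rightarrow> int) \<Rightarrow> ((nat \<Rightarrow> int) \<times> 'k ratfun \<Rightarrow>\<^sub>0 int) set" where
  "Mexp p m \<theta> = (\<Otimes>\<^bsub>Mmod p\<^esub>s\<in>galQ.
     tensor_map (add_monoid (Zp p)) ratfun_units (\<lambda>c. \<theta> s \<otimes>\<^bsub>Zp p\<^esub> c) (ratfun_map s) m)"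

definition eps_omega :: "nat \<Rightarrow> 'k::field_char_0 \<Rightarrow> ('k \<Rightarrow> 'k) \<Rightarrow> nat \<Rightarrow> int" where
  "eps_omega p \<zeta> = (\<lambda>s. inv\<^bsub>Zp p\<^esub> ([(p - 1)] \<cdot>\<^bsub>Zp p\<^esub> \<one>\<^bsub>Zp p\<^esub>)
     \<otimes>\<^bsub>Zp p\<^esub> inv\<^bsub>Zp p\<^esub> (teichmueller_char p \<zeta> s))"

end

theory Submission
  imports Defs
    "HOL-Computational_Algebra.Polynomial_Factorial"
    "HOL-Computational_Algebra.Field_as_Ring"
    "HOL-Number_Theory.Residues"
begin

text \<open>
  The relation is tested at one point. For \<open>\<alpha>\<close> in \<open>K\<close>, the order of vanishing at \<open>\<alpha>\<close>, taken modulo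
  \<open>p\<close>, is a homomorphism on the tensor product which kills \<open>p\<close>-th powers and constants
  (\<open>Mmod_order_char\<close>). Let \<open>s\<^sub>k\<close> be the automorphism with \<open>s\<^sub>k \<zeta> = \<zeta>\<^sup>k\<close>. Modulo \<open>p\<close> its coefficient in
  \<open>\<epsilon>\<close> is \<open>- 1 / k\<close> (\<open>eps_omega_residue\<close>), and so it is different for different \<open>k\<close>.

  Choose \<open>\<alpha> = - 1 / \<zeta>\<^sup>\<lambda>\<close>. Among the conjugates \<open>1 + Y \<zeta>\<^bsup>\<lambda>k\<^esup>\<close> only the one with \<open>k = 1\<close> vanishes at
  \<open>\<alpha>\<close>, so the right-hand side has order \<open>- 1\<close>. On the left, an automorphism of the field of rational
  functions has the form \<open>T(Y) = (a Y + b) / (c Y + d)\<close> with rational coefficients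
  (\<open>field_aut_ratfun_moebius\<close>). The denominator does not vanish at the irrational number \<open>\<alpha>\<close>, and the
  numerators \<open>(c Y + d) + (a Y + b) \<zeta>\<^sup>k\<close> are linear in \<open>Y\<close> and in \<open>\<zeta>\<^sup>k\<close>, so at most one \<open>k\<close>
  contributes, with the value \<open>- 1 / k\<close>. Hence \<open>k = 1\<close> contributes, that is,
  \<open>(c \<alpha> + d) + (a \<alpha> + b) \<zeta> = 0\<close>, or
  \<open>d \<zeta>\<^sup>\<lambda> + b \<zeta>\<^bsup>\<lambda> + 1\<^esup> = c + a \<zeta>\<close>.

  As \<open>p \<ge> 5\<close>, the powers of \<open>\<zeta>\<close> that occur here are linearly independent over the rationals, by
  irreducibility of the \<open>p\<close>-th cyclotomic polynomial. So the terms must cancel against each other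
  (\<open>four_term_relation\<close>): either \<open>\<lambda> = 1\<close> modulo \<open>p\<close> and \<open>T(Y) = Y\<close>, or \<open>\<lambda> = - 1\<close> modulo \<open>p\<close> and
  \<open>T(Y) = 1 / Y\<close>.
\<close>

hide_const (open) up_ring.coeff up_ring.monom Module.smult


section \<open>Rational relations between powers of a root of unity of prime order\<close>

text \<open>Since \<open>q\<close> does not divide the constant coefficient of \<open>g\<close>, divisibility climbs through the
  coefficients of \<open>f\<close> one by one.\<close>

lemma prime_dvd_coeffs_left_factor:
  fixes f g :: "int poly"
  assumes q: "prime q" and f0: "q dvd coeff f 0" and g0: "\<not> q dvd coeff g 0"
    and fg: "\<And>i. i < n \<Longrightarrow> q dvd coeff (f * g) i" and i: "i < n"
  shows "q dvd coeff f i"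
  using i
proof (induction i rule: less_induct)
  case (less i)
  show ?case
  proof (cases "i = 0")
    case False
    have "{..i} = insert i {..<i}" by auto
    then have "coeff (f * g) i = coeff f i * coeff g 0 + (\<Sum>j<i. coeff f j * coeff g (i - j))"
      by (simp add: coeff_mult)
    moreover have "q dvd (\<Sum>j<i. coeff f j * coeff g (i - j))"
      using less by (intro dvd_sum) auto
    ultimately have "q dvd coeff f i * coeff g 0"
      using fg[OF less.prems] by (metis dvd_add_left_iff)
    then show ?thesis using q g0 by (simp add: prime_dvd_mult_iff)
  qed (use f0 in simp)
qed

text \<open>Eisenstein's criterion. The hypothesis on the constant coefficient makes \<open>q\<close> divide that of
  exactly one factor; if the other factor is not constant, then the divisibility reaches the leading
  coefficient.\<close>

lemma eisenstein:
  fixes f g :: "int poly"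
  assumes q: "prime q"
    and low: "\<And>i. i < degree (f * g) \<Longrightarrow> q dvd coeff (f * g) i"
    and lead: "\<not> q dvd lead_coeff (f * g)"
    and const: "\<not> q\<^sup>2 dvd coeff (f * g) 0"
  shows "degree f = 0 \<or> degree g = 0"
proof (rule ccontr)
  assume "\<not> ?thesis"
  moreover have "f \<noteq> 0" "g \<noteq> 0" using lead by auto
  ultimately have deg: "degree f < degree (f * g)" "degree g < degree (f * g)"
    by (auto simp: degree_mult_eq)
  have c0: "coeff (f * g) 0 = coeff f 0 * coeff g 0" by (simp add: coeff_mult)
  have "q dvd coeff (f * g) 0" using deg by (intro low) simp
  then have "q dvd coeff f 0 \<or> q dvd coeff g 0"
    using q by (simp add: c0 prime_dvd_mult_iff)
  moreover have "\<not> (q dvd coeff f 0 \<and> q dvd coeff g 0)"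
    using const by (auto simp: c0 power2_eq_square intro: mult_dvd_mono)
  ultimately consider "q dvd coeff f 0" "\<not> q dvd coeff g 0" | "q dvd coeff g 0" "\<not> q dvd coeff f 0"
    by blast
  then have "q dvd lead_coeff f \<or> q dvd lead_coeff g"
  proof cases
    case 1
    then show ?thesis using prime_dvd_coeffs_left_factor[OF q 1 low deg(1)] by simp
  next
    case 2
    then show ?thesis
      using prime_dvd_coeffs_left_factor[OF q 2, of "degree (f * g)" "degree g"] low deg(2)
      by (simp add: mult.commute)
  qed
  then show False using lead by (auto simp: lead_coeff_mult)
qed

lemma poly_of_int_add:
  "poly (map_poly of_int (f + g)) x = poly (map_poly of_int f) x + poly (map_poly of_int g) (x :: 'a::comm_ring_1)"
proof -
  have "map_poly of_int (f + g) = map_poly of_int f + (map_poly of_int g :: 'a poly)"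
    by (rule poly_eqI) (simp add: coeff_map_poly)
  then show ?thesis by simp
qed

lemma poly_of_int_mult:
  "poly (map_poly of_int (f * g)) x = poly (map_poly of_int f) x * poly (map_poly of_int g) (x :: 'a::comm_ring_1)"
proof -
  have "map_poly of_int (f * g) = map_poly of_int f * (map_poly of_int g :: 'a poly)"
    by (rule poly_eqI) (simp add: coeff_map_poly coeff_mult)
  then show ?thesis by simp
qed

lemma poly_of_int_smult:
  "poly (map_poly of_int (smult c f)) x = of_int c * poly (map_poly of_int f) (x :: 'a::comm_ring_1)"
  by (simp add: map_poly_smult)

text \<open>Take an integer polynomial of least degree with root \<open>x\<close> and make it primitive. Pseudo-division
  and Gauss's lemma show that it divides \<open>E\<close> over the integers, so Eisenstein's criterion makes the
  cofactor constant.\<close>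

lemma eisenstein_minimal_degree:
  fixes E F :: "int poly" and x :: "'a::field_char_0"
  assumes q: "prime q"
    and low: "\<And>i. i < degree E \<Longrightarrow> q dvd coeff E i"
    and lead: "\<not> q dvd lead_coeff E"
    and const: "\<not> q\<^sup>2 dvd coeff E 0"
    and E: "poly (map_poly of_int E) x = 0"
    and F: "poly (map_poly of_int F) x = 0" "F \<noteq> 0"
  shows "degree E \<le> degree F"
proof -
  define P where "P f \<longleftrightarrow> f \<noteq> 0 \<and> poly (map_poly of_int f) x = 0" for f :: "int poly"
  obtain G where G: "P G" and min: "\<And>f. P f \<Longrightarrow> degree G \<le> degree f"
    using F by (metis P_def ex_has_least_nat)
  define H where "H = primitive_part G"
  have GH: "G = smult (content G) H" by (simp add: H_def)
  have "G \<noteq> 0" using G P_def by auto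
  then have c: "content G \<noteq> 0" by simp
  have H: "P H"
  proof -
    have "poly (map_poly of_int G) x = of_int (content G) * poly (map_poly of_int H) x"
      by (subst GH) (simp add: poly_of_int_smult)
    then show ?thesis using G c by (auto simp: P_def H_def)
  qed
  have degH: "degree H = degree G" by (simp add: H_def)
  have contH: "content H = 1" using \<open>G \<noteq> 0\<close> by (simp add: H_def)
  have "H \<noteq> 0" using H P_def by auto
  from pseudo_mod[OF this, of E]
  obtain a s r where a: "a \<noteq> 0" and div: "smult a E = H * s + r"
    and r: "r = 0 \<or> degree r < degree H" by blast
  have "poly (map_poly of_int (smult a E)) x = 0"
    using E by (simp add: poly_of_int_smult)
  then have "poly (map_poly of_int r) x = 0"
    using H by (simp add: div poly_of_int_add poly_of_int_mult P_def)
  with r min[of r] degH have "r = 0" unfolding P_def by (metis linorder_not_less)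
  with div have div: "smult a E = H * s" by simp
  have "content (H * s) = content s" by (simp add: content_mult contH)
  then have "a dvd content s" using div by (metis content_smult dvd_normalize_iff dvd_triv_left normalize_dvd_iff)
  then obtain t where "s = smult a t"
    by (metis const_poly_dvd_iff_dvd_content dvdE mult_pCons_left mult_zero_left pCons_0_0 add_0_right)
  with div have "smult a (E - H * t) = 0" by (simp add: smult_diff_right)
  with a have EHt: "E = H * t" by simp
  have "degree H = 0 \<or> degree t = 0"
    by (rule eisenstein[OF q low[unfolded EHt] lead[unfolded EHt] const[unfolded EHt]])
  moreover have "degree H \<noteq> 0"
  proof
    assume "degree H = 0"
    then obtain h where "H = [:h:]" by (metis degree_eq_zeroE)
    then show False using H by (auto simp: P_def map_poly_pCons)
  qed
  ultimately have "degree t = 0" by blast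
  moreover have "E \<noteq> 0" using lead by auto
  ultimately have "degree E = degree H" using EHt by (auto simp: degree_mult_eq)
  then show ?thesis using min[of F] F degH by (simp add: P_def)
qed
lemma poly_of_int_shift:
  "poly (map_poly of_int (f \<circ>\<^sub>p [:1, 1:])) x = poly (map_poly of_int f) (x + 1 :: 'a::comm_ring_1)"
proof (induction f)
  case (pCons a f)
  then show ?case
    by (simp add: pcompose_pCons poly_of_int_add poly_of_int_mult map_poly_pCons algebra_simps
        del: mult_pCons_left)
qed simp

text \<open>The polynomial \<open>((X + 1)\<^sup>p - 1) / X\<close> has the root \<open>z - 1\<close> and the coefficients \<open>p choose (i + 1)\<close>,
  and is therefore Eisenstein at \<open>p\<close>.\<close>

lemma primitive_root_minimal_degree:
  fixes z :: "'a::field_char_0" and F :: "int poly"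
  assumes p: "prime p" and z: "primitive_root_of_unity p z"
    and F: "poly (map_poly of_int F) z = 0" "degree F < p - 1"
  shows "F = 0"
proof (rule ccontr)
  assume "F \<noteq> 0"
  have p1: "p > 1" using p by (rule prime_gt_1_nat)
  define E where "E = (\<Sum>i<p. monom (int (p choose Suc i)) i)"
  have coeff_E: "coeff E i = int (p choose Suc i)" for i
    by (auto simp: E_def coeff_sum sum.delta[of "{..<p}" i] if_distrib cong: if_cong)
  have deg_E: "degree E = p - 1"
  proof (rule antisym)
    show "degree E \<le> p - 1" by (rule degree_le) (use p1 in \<open>auto simp: coeff_E\<close>)
    show "p - 1 \<le> degree E" by (rule le_degree) (use p1 in \<open>auto simp: coeff_E\<close>)
  qed
  have root: "poly (map_poly of_int E) (z - 1) = 0"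
  proof -
    have "map_poly of_int E = (\<Sum>i<p. monom (of_nat (p choose Suc i) :: 'a) i)"
      by (rule poly_eqI)
        (auto simp: coeff_E coeff_map_poly coeff_sum sum.delta[of "{..<p}"] if_distrib cong: if_cong)
    then have "(z - 1) * poly (map_poly of_int E) (z - 1) + 1
        = (\<Sum>i<p. of_nat (p choose Suc i) * (z - 1) ^ Suc i) + 1"
      by (simp add: poly_sum poly_monom sum_distrib_left algebra_simps)
    also have "\<dots> = (\<Sum>i\<le>p. of_nat (p choose i) * (z - 1) ^ i * 1 ^ (p - i))"
      by (subst sum.atMost_shift) simp
    also have "\<dots> = 1"
      using z by (subst binomial_ring[symmetric]) (simp add: primitive_root_of_unity_def)
    finally have "(z - 1) * poly (map_poly of_int E) (z - 1) = 0" by simp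
    moreover have "z \<noteq> 1"
      using z p1 unfolding primitive_root_of_unity_def by (metis less_numeral_extra(1) power_one_right)
    ultimately show ?thesis by simp
  qed
  have "degree E \<le> degree (F \<circ>\<^sub>p [:1, 1:])"
  proof (rule eisenstein_minimal_degree)
    show "prime (int p)" using p by simp
    show "int p dvd coeff E i" if "i < degree E" for i
      using that p deg_E by (auto simp: coeff_E intro!: dvd_choose_prime)
    show "\<not> int p dvd lead_coeff E"
      using p1 by (simp add: coeff_E deg_E)
    show "\<not> (int p)\<^sup>2 dvd coeff E 0"
    proof
      assume "(int p)\<^sup>2 dvd coeff E 0"
      then have "p\<^sup>2 dvd p" by (simp add: coeff_E flip: of_nat_power)
      then show False using p1 by (auto simp: power2_eq_square dest: dvd_imp_le)
    qed
    show "poly (map_poly of_int E) (z - 1) = 0" by (fact root)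
    show "poly (map_poly of_int (F \<circ>\<^sub>p [:1, 1:])) (z - 1) = 0"
      using F by (simp add: poly_of_int_shift)
    show "F \<circ>\<^sub>p [:1, 1:] \<noteq> 0" using \<open>F \<noteq> 0\<close> by (simp add: pcompose_eq_0_iff)
  qed
  then show False using F(2) by (simp add: deg_E degree_pcompose)
qed

lemma common_denominator:
  fixes r :: "'b \<Rightarrow> rat"
  assumes "finite A"
  shows "\<exists>d n. d \<noteq> 0 \<and> (\<forall>i\<in>A. of_int d * r i = of_int (n i))"
proof -
  define d where "d = (\<Prod>i\<in>A. snd (quotient_of (r i)))"
  have "\<exists>m. of_int d * r i = of_int m" if "i \<in> A" for i
  proof -
    have "r i = of_int (fst (quotient_of (r i))) / of_int (snd (quotient_of (r i)))"
      by (metis prod.collapse quotient_of_div)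
    moreover have "snd (quotient_of (r i)) \<noteq> 0"
      using quotient_of_denom_pos'[of "r i"] by simp
    moreover have "d = snd (quotient_of (r i)) * (\<Prod>j\<in>A - {i}. snd (quotient_of (r j)))"
      unfolding d_def using assms that by (rule prod.remove)
    ultimately have "of_int d * r i
        = of_int (fst (quotient_of (r i)) * (\<Prod>j\<in>A - {i}. snd (quotient_of (r j))))"
      by (simp add: field_simps)
    then show ?thesis by blast
  qed
  moreover have "d \<noteq> 0"
    using assms quotient_of_denom_pos'[of "r _"] by (simp add: d_def less_imp_neq[symmetric])
  ultimately show ?thesis by metis
qed

lemma primitive_root_sum_zero:
  fixes z :: "'a::field"
  assumes "p > 1" and z: "primitive_root_of_unity p z"
  shows "(\<Sum>i<p. z ^ i) = 0"
proof -
  have "z \<noteq> 1" "z ^ p = 1"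
    using assms unfolding primitive_root_of_unity_def by (metis less_numeral_extra(1) power_one_right)+
  then show ?thesis by (simp add: geometric_sum)
qed

text \<open>The only relation is \<open>1 + z + \<dots> + z\<^bsup>p - 1\<^esup> = 0\<close>: subtracting a multiple of it removes the top
  term, and a relation of degree below \<open>p - 1\<close> is trivial.\<close>

lemma primitive_root_relation:
  fixes z :: "'a::field_char_0" and r :: "nat \<Rightarrow> rat"
  assumes p: "prime p" and z: "primitive_root_of_unity p z"
    and rel: "(\<Sum>i<p. of_rat (r i) * z ^ i) = 0" and ij: "i < p" "j < p"
  shows "r i = r j"
proof -
  have p1: "p > 1" using p by (rule prime_gt_1_nat)
  then have split: "{..<p} = insert (p - 1) {..<p - 1}" by auto
  define r' where "r' i = r i - r (p - 1)" for i
  obtain d n where d: "d \<noteq> 0" and n: "\<And>i. i \<in> {..<p} \<Longrightarrow> of_int d * r' i = of_int (n i)"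
    using common_denominator[of "{..<p}" r'] by blast
  define F where "F = (\<Sum>i<p - 1. monom (n i) i)"
  have coeff_F: "coeff F i = (if i < p - 1 then n i else 0)" for i
    by (auto simp: F_def coeff_sum sum.delta[of "{..<p - 1}" i] if_distrib cong: if_cong)
  have "of_rat (of_int d * r' i) = (of_int (n i) :: 'a)" if "i < p" for i
    using n[of i] that by simp
  then have n': "of_int (n i) = of_int d * (of_rat (r' i) :: 'a)" if "i < p" for i
    using that by (simp add: of_rat_mult)
  have "map_poly of_int F = (\<Sum>i<p - 1. monom (of_int (n i) :: 'a) i)"
    by (rule poly_eqI)
      (auto simp: coeff_F coeff_map_poly coeff_sum sum.delta[of "{..<p - 1}"] if_distrib cong: if_cong)
  then have "poly (map_poly of_int F) z = (\<Sum>i<p - 1. of_int (n i) * z ^ i)"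
    by (simp add: poly_sum poly_monom)
  also have "\<dots> = (\<Sum>i<p - 1. of_int d * (of_rat (r' i) * z ^ i))"
    by (intro sum.cong) (auto simp: n')
  also have "\<dots> = of_int d * (\<Sum>i<p. of_rat (r' i) * z ^ i)"
    by (simp add: split r'_def sum_distrib_left)
  also have "(\<Sum>i<p. of_rat (r' i) * z ^ i)
      = (\<Sum>i<p. of_rat (r i) * z ^ i) - of_rat (r (p - 1)) * (\<Sum>i<p. z ^ i)"
    by (simp add: r'_def of_rat_diff sum_subtractf sum_distrib_left
        left_diff_distrib)
  also have "\<dots> = 0" using rel primitive_root_sum_zero[OF p1 z] by simp
  finally have "poly (map_poly of_int F) z = 0" by simp
  moreover have "degree F < p - 1"
    using p1 by (intro degree_lessI) (auto simp: coeff_F)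
  ultimately have "F = 0" by (rule primitive_root_minimal_degree[OF p z])
  then have "n i = 0" if "i < p - 1" for i
    using coeff_F[of i] that by simp
  then have "r' i = 0" if "i < p - 1" for i
    using n[of i] d that by simp
  then have "r i = r (p - 1)" if "i < p" for i
    using that by (cases "i = p - 1") (auto simp: r'_def)
  then show ?thesis using ij by metis
qed

text \<open>At least one of the \<open>p \<ge> 5\<close> exponents does not occur, so all coefficients vanish after terms
  with equal exponents are collected. The exponents \<open>l\<close>, \<open>l + 1\<close>, \<open>0\<close>, \<open>1\<close> can only coincide
  modulo \<open>p\<close> when \<open>l\<close> is \<open>1\<close> or \<open>- 1\<close>. For \<open>p = 3\<close> there are further solutions, since all three
  powers can occur and their sum is zero.\<close>

lemma four_term_relation:
  fixes z :: "'a::field_char_0" and a b c d :: rat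
  assumes p: "prime p" "p > 3" and z: "primitive_root_of_unity p z" and l: "0 < l" "l < p"
    and rel: "of_rat d * z ^ l + of_rat b * z ^ Suc l = of_rat c + of_rat a * z"
  shows "a = 0 \<and> b = 0 \<and> c = 0 \<and> d = 0 \<or> l = 1 \<and> b = 0 \<and> c = 0 \<and> a = d
    \<or> l = p - 1 \<and> a = 0 \<and> d = 0 \<and> b = c"
proof -
  define m where "m = Suc l mod p"
  have m: "m < p" using p by (simp add: m_def)
  have "z ^ p = 1" using z by (simp add: primitive_root_of_unity_def)
  then have zm: "z ^ Suc l = z ^ m"
    using l by (cases "Suc l = p") (auto simp: m_def)
  define r where "r i = (if i = l then d else 0) + (if i = m then b else 0)
     - (if i = 0 then c else 0) - (if i = 1 then a else 0)" for i
  have "(\<Sum>i<p. of_rat (r i) * z ^ i) =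
      (\<Sum>i<p. (if i = l then of_rat d * z ^ i else 0) + (if i = m then of_rat b * z ^ i else 0)
      - (if i = 0 then of_rat c * z ^ i else 0) - (if i = 1 then of_rat a * z ^ i else 0))"
    by (intro sum.cong) (auto simp: r_def of_rat_add of_rat_diff of_rat_minus algebra_simps)
  also have "\<dots> = of_rat d * z ^ l + of_rat b * z ^ m - of_rat c - of_rat a * z"
    using l m p by (simp add: sum.distrib sum_subtractf)
  also have "\<dots> = 0" using rel unfolding zm by simp
  finally have r: "r i = r j" if "i < p" "j < p" for i j
    using primitive_root_relation[OF p(1) z] that by blast
  have "p \<noteq> 4" using p(1) by auto
  then have "p \<ge> 5" using p by simp
  have "card {0, 1, l, m} \<le> 4" by (simp add: card_insert_if)
  then have "\<not> {..<p} \<subseteq> {0, 1, l, m}"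
    using \<open>p \<ge> 5\<close> card_mono[of "{0, 1, l, m}" "{..<p}"] by auto
  then obtain j where "j < p" "j \<notin> {0, 1, l, m}" by auto
  then have "r j = 0" by (simp add: r_def)
  then have "r i = 0" if "i < p" for i
    using r[OF that \<open>j < p\<close>] by simp
  then have r0: "r 0 = 0" "r 1 = 0" "r l = 0" "r m = 0"
    using l m p by simp_all
  consider "l = 1" "m = 2" | "l = p - 1" "m = 0" | "l > 1" "m > 1" "m \<noteq> l"
    using l p by (cases "l = 1"; cases "Suc l = p") (auto simp: m_def)
  then show ?thesis
    using r0 p by cases (auto simp: r_def split: if_splits)
qed



section \<open>Automorphisms of the field of rational functions\<close>

text \<open>The rational root theorem in homogeneous form.\<close>

lemma homogeneous_root_dvd_coeffs:
  fixes P Q :: "'a::ring_gcd" and c :: "nat \<Rightarrow> 'a"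
  assumes cop: "coprime P Q" and eq: "(\<Sum>i\<le>n. c i * P ^ i * Q ^ (n - i)) = 0"
  shows "P dvd c 0" and "Q dvd c n"
proof -
  have "{..n} = insert n {..<n}" by auto
  with eq have "c n * P ^ n + (\<Sum>i<n. c i * P ^ i * Q ^ (n - i)) = 0" by simp
  then have "c n * P ^ n = - (\<Sum>i<n. c i * P ^ i * Q ^ (n - i))"
    by (simp add: eq_neg_iff_add_eq_0)
  moreover have "Q dvd (\<Sum>i<n. c i * P ^ i * Q ^ (n - i))"
    by (intro dvd_sum dvd_mult dvd_power) auto
  ultimately have "Q dvd c n * P ^ n" by simp
  moreover have "coprime Q (P ^ n)" using cop by (simp add: coprime_commute)
  ultimately show "Q dvd c n" by (simp add: coprime_dvd_mult_left_iff)
  have "{..n} = insert 0 {0<..n}" by auto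
  with eq have "c 0 * Q ^ n + (\<Sum>i\<in>{0<..n}. c i * P ^ i * Q ^ (n - i)) = 0" by simp
  then have "c 0 * Q ^ n = - (\<Sum>i\<in>{0<..n}. c i * P ^ i * Q ^ (n - i))"
    by (simp add: eq_neg_iff_add_eq_0)
  moreover have "P dvd (\<Sum>i\<in>{0<..n}. c i * P ^ i * Q ^ (n - i))"
    by (intro dvd_sum dvd_mult2 dvd_mult dvd_power) auto
  ultimately have "P dvd c 0 * Q ^ n" by simp
  moreover have "coprime P (Q ^ n)" using cop by simp
  ultimately show "P dvd c 0" by (simp add: coprime_dvd_mult_left_iff)
qed

lemma field_aut_simps:
  assumes "field_aut T"
  shows "T 0 = 0" "T 1 = 1" "T (x + y) = T x + T y" "T (x * y) = T x * T y"
    "T (x ^ n) = T x ^ n" "T (of_nat n) = of_nat n" "T (- x) = - T x" "T (of_int k) = of_int k"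
    "T (x / y) = T x / T y" "T (sum f A) = (\<Sum>i\<in>A. T (f i))" "T x = T y \<longleftrightarrow> x = y"
    "T x = 0 \<longleftrightarrow> x = 0"
proof -
  show add: "T (x + y) = T x + T y" and mult: "T (x * y) = T x * T y" and one: "T 1 = 1" for x y
    using assms by (auto simp: field_aut_def)
  show zero: "T 0 = 0" by (metis add add_0 add_cancel_right_left)
  show inj: "T x = T y \<longleftrightarrow> x = y" for x y
    using assms by (auto simp: field_aut_def bij_def dest: injD)
  then show z: "T x = 0 \<longleftrightarrow> x = 0" for x using zero by metis
  show "T (x ^ n) = T x ^ n" by (induction n) (auto simp: one mult)
  show n: "T (of_nat n) = of_nat n" for n by (induction n) (auto simp: one add zero)
  show m: "T (- x) = - T x" for x
    using add[of x "- x"] zero by (simp add: eq_neg_iff_add_eq_0 add.commute)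
  show "T (of_int k) = of_int k" by (cases k rule: int_cases2) (auto simp: n m)
  show "T (x / y) = T x / T y"
  proof (cases "y = 0")
    case False
    then show ?thesis using mult[of "x / y" y] z by (simp add: field_simps)
  qed (simp add: zero)
  show "T (sum f A) = (\<Sum>i\<in>A. T (f i))"
    by (induction A rule: infinite_finite_induct) (auto simp: zero add)
qed

lemma ratfun_const_to_fract: "ratfun_const c = to_fract [:c:]"
  by (simp add: ratfun_const_def to_fract_def)

lemma ratfun_var_to_fract: "ratfun_var = to_fract [:0, 1:]"
  by (simp add: ratfun_var_def to_fract_def)

lemma ratfun_const_of_int: "ratfun_const (of_int k) = of_int k"
proof -
  have "to_fract (of_int k :: 'a poly) = of_int k" for k
  proof (cases k)
    case (nonneg n)
    have "to_fract (of_nat n :: 'a poly) = of_nat n" by (induction n) auto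
    with nonneg show ?thesis by simp
  next
    case (neg n)
    have "to_fract (of_nat n :: 'a poly) = of_nat n" for n by (induction n) auto
    from this[of "Suc n"] show ?thesis unfolding neg by (simp del: of_nat_Suc)
  qed
  then show ?thesis by (simp add: ratfun_const_to_fract of_int_poly)
qed

text \<open>A rational number is a quotient of integers, and these are fixed.\<close>

lemma field_aut_ratfun_const:
  fixes T :: "rat ratfun \<Rightarrow> rat ratfun"
  assumes T: "field_aut T"
  shows "T (ratfun_const q) = ratfun_const q"
proof -
  obtain a b where ab: "quotient_of q = (a, b)" by fastforce
  have b: "b > 0" using quotient_of_denom_pos[OF ab] .
  have "q = of_int a / of_int b" by (rule quotient_of_div[OF ab])
  then have "q * of_int b = of_int a" using b by simp
  then have "ratfun_const q * ratfun_const (of_int b) = ratfun_const (of_int a)"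
    by (simp add: ratfun_const_to_fract mult.commute flip: to_fract_mult)
  moreover have "ratfun_const (of_int b :: rat) \<noteq> 0" using b by (simp add: ratfun_const_to_fract)
  ultimately have "ratfun_const q = of_int a / of_int b"
    by (simp add: ratfun_const_of_int field_simps)
  then show ?thesis using field_aut_simps[OF T] by simp
qed

lemma to_fract_power: "to_fract (x ^ n) = to_fract x ^ n"
  by (induction n) auto

lemma field_aut_to_fract:
  fixes T :: "rat ratfun \<Rightarrow> rat ratfun"
  assumes T: "field_aut T" and n: "degree f \<le> n"
  shows "T (to_fract f) = (\<Sum>i\<le>n. ratfun_const (coeff f i) * T ratfun_var ^ i)"
proof -
  have "to_fract f = (\<Sum>i\<le>n. to_fract (monom (coeff f i) i))"
    by (subst poly_as_sum_of_monoms'[OF n, symmetric]) (simp only: to_fract_sum)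
  moreover have "to_fract (monom c i) = ratfun_const c * ratfun_var ^ i" for c :: rat and i
    by (simp add: ratfun_const_to_fract ratfun_var_to_fract monom_altdef flip: to_fract_power to_fract_mult)
  ultimately show ?thesis
    by (simp add: field_aut_simps[OF T] field_aut_ratfun_const[OF T])
qed

lemma field_aut_eq_id:
  fixes T :: "rat ratfun \<Rightarrow> rat ratfun"
  assumes T: "field_aut T" and Y: "T ratfun_var = ratfun_var"
  shows "T = id"
proof -
  have id: "field_aut (id :: rat ratfun \<Rightarrow> rat ratfun)" by (simp add: field_aut_def)
  have poly: "T (to_fract f) = to_fract f" for f
    using field_aut_to_fract[OF T order_refl, of f] field_aut_to_fract[OF id order_refl, of f] Y by simp
  have "T r = r" for r
    by (cases r) (simp add: Fract_conv_to_fract field_aut_simps[OF T] poly)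
  then show ?thesis by auto
qed

lemma ratfun_coprime_cases:
  fixes r :: "rat ratfun"
  obtains P Q where "Q \<noteq> 0" "coprime P Q" "r = to_fract P / to_fract Q"
  using that[of "snd (quot_of_fract r)" "fst (quot_of_fract r)"]
  by (metis Fract_conv_to_fract Fract_quot_of_fract coprime_quot_of_fract snd_quot_of_fract_nonzero)

text \<open>Let \<open>R = A / B\<close> be the preimage of \<open>Y\<close>. Applying \<open>T\<close> to \<open>R B = A\<close> shows that \<open>T Y = P / Q\<close> is a
  root of the polynomial \<open>A - Y B\<close>, whose coefficients \<open>a\<^sub>i - Y b\<^sub>i\<close> have degree at most one in \<open>Y\<close>.
  By the rational root theorem \<open>P\<close> and \<open>Q\<close> divide the extreme coefficients.\<close>

lemma field_aut_ratfun_var_degree: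
  fixes T :: "rat ratfun \<Rightarrow> rat ratfun"
  assumes T: "field_aut T" and PQ: "coprime P Q" "Q \<noteq> 0" "T ratfun_var = to_fract P / to_fract Q"
  shows "degree P \<le> 1" "degree Q \<le> 1"
proof -
  have "surj T" using T by (simp add: field_aut_def bij_def)
  then obtain R where R: "T R = ratfun_var" by (metis surjD)
  obtain A B where AB: "B \<noteq> 0" "coprime A B" "R = to_fract A / to_fract B"
    by (rule ratfun_coprime_cases)
  define n where "n = max (degree A) (degree B)"
  \<comment> \<open>The form of degree \<open>n\<close> belonging to \<open>f\<close>, evaluated at \<open>(P, Q)\<close>: it clears denominators in
    \<open>f(P / Q)\<close>.\<close>
  define h where "h f = (\<Sum>i\<le>n. [:coeff f i:] * P ^ i * Q ^ (n - i))" for f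
  have h: "to_fract (h f) = to_fract Q ^ n * T (to_fract f)" if "degree f \<le> n" for f
  proof -
    have "to_fract (h f) = (\<Sum>i\<le>n. ratfun_const (coeff f i) * to_fract P ^ i * to_fract Q ^ (n - i))"
      by (simp only: h_def to_fract_sum to_fract_mult to_fract_power ratfun_const_to_fract)
    also have "\<dots> = (\<Sum>i\<le>n. to_fract Q ^ n * (ratfun_const (coeff f i) * T ratfun_var ^ i))"
    proof (rule sum.cong)
      fix i assume "i \<in> {..n}"
      then have "to_fract Q ^ n = to_fract Q ^ (n - i) * to_fract Q ^ i"
        by (simp flip: power_add)
      then show "ratfun_const (coeff f i) * to_fract P ^ i * to_fract Q ^ (n - i)
          = to_fract Q ^ n * (ratfun_const (coeff f i) * T ratfun_var ^ i)"
        using PQ(2) by (simp add: PQ(3) power_divide)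
    qed simp
    also have "\<dots> = to_fract Q ^ n * T (to_fract f)"
      using that by (simp add: field_aut_to_fract[OF T] sum_distrib_left)
    finally show ?thesis .
  qed
  have "T (to_fract A) = ratfun_var * T (to_fract B)"
    using AB(1) by (simp add: R[symmetric] AB(3) field_aut_simps[OF T])
  then have "to_fract (h A) = to_fract ([:0, 1:] * h B)"
    by (simp only: to_fract_mult h n_def max.cobounded1 max.cobounded2 ratfun_var_to_fract mult.left_commute)
  then have "h A = [:0, 1:] * h B" by (simp only: to_fract_eq_iff)
  then have "0 = h A - [:0, 1:] * h B" by simp
  also have "\<dots> = (\<Sum>i\<le>n. ([:coeff A i:] - [:0, 1:] * [:coeff B i:]) * P ^ i * Q ^ (n - i))"
    by (simp only: h_def sum_distrib_left sum_subtractf left_diff_distrib mult.assoc)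
  also have "\<dots> = (\<Sum>i\<le>n. [:coeff A i, - coeff B i:] * P ^ i * Q ^ (n - i))"
    by simp
  finally have dvd: "P dvd [:coeff A 0, - coeff B 0:]" "Q dvd [:coeff A n, - coeff B n:]"
    using homogeneous_root_dvd_coeffs[OF PQ(1), of "\<lambda>i. [:coeff A i, - coeff B i:]" n] by simp_all
  \<comment> \<open>Here coprimality of \<open>A\<close> and \<open>B\<close> enters: they do not both vanish at 0.\<close>
  have "[:coeff A 0, - coeff B 0:] \<noteq> 0"
  proof
    assume "[:coeff A 0, - coeff B 0:] = 0"
    then have "poly A 0 = 0" "poly B 0 = 0" by (auto simp: poly_0_coeff_0)
    then have "[:0, 1:] dvd A" "[:0, 1:] dvd B" by (simp_all add: poly_eq_0_iff_dvd)
    then have "is_unit [:0, 1 :: rat:]" using AB(2) by (meson coprime_common_divisor)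
    then show False by (simp add: is_unit_poly_iff)
  qed
  then show "degree P \<le> 1"
    using dvd_imp_degree_le[OF dvd(1)] by (simp split: if_splits)
  have "coeff A n \<noteq> 0 \<or> coeff B n \<noteq> 0"
    using AB(1) by (cases "degree A \<le> degree B") (auto simp: n_def max_def)
  then have "[:coeff A n, - coeff B n:] \<noteq> 0" by auto
  then show "degree Q \<le> 1"
    using dvd_imp_degree_le[OF dvd(2)] by (simp split: if_splits)
qed

lemma degree_le_1_cases:
  assumes "degree f \<le> 1"
  obtains a b where "f = [:b, a:]"
proof -
  have "f = [:coeff f 0, coeff f 1:]"
    by (rule poly_eqI) (use assms in \<open>auto simp: coeff_pCons coeff_eq_0 split: nat.splits\<close>)
  then show ?thesis by (rule that)
qed

lemma field_aut_ratfun_moebius: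
  fixes T :: "rat ratfun \<Rightarrow> rat ratfun"
  assumes T: "field_aut T"
  obtains a b c d where "[:d, c:] \<noteq> 0" "T ratfun_var = Fract [:b, a:] [:d, c:]"
proof -
  obtain P Q where PQ: "Q \<noteq> 0" "coprime P Q" "T ratfun_var = to_fract P / to_fract Q"
    by (rule ratfun_coprime_cases)
  then have "degree P \<le> 1" "degree Q \<le> 1" using field_aut_ratfun_var_degree[OF T] by auto
  then obtain a b c d where "P = [:b, a:]" "Q = [:d, c:]" using degree_le_1_cases by metis
  with PQ that show ?thesis by (metis Fract_conv_to_fract)
qed


section \<open>Roots of unity in the \<open>p\<close>-adic integers\<close>

text \<open>Factor \<open>a\<^sup>p - b\<^sup>p\<close>: the cofactor of \<open>a - b\<close> is congruent to \<open>p b\<^bsup>p - 1\<^esup>\<close> modulo \<open>p\<close>, which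
  supplies one more factor \<open>p\<close>.\<close>

lemma cong_power_lift:
  fixes a b :: int
  assumes n: "n > 0" and ab: "[a = b] (mod int p ^ n)"
  shows "[a ^ p = b ^ p] (mod int p ^ Suc n)"
proof (cases p)
  case (Suc q)
  have ab1: "[a = b] (mod int p)"
    using ab by (rule cong_dvd_modulus) (use n in simp)
  have "[(\<Sum>i<p. b ^ (p - Suc i) * a ^ i) = (\<Sum>i<p. b ^ (p - Suc i) * b ^ i)] (mod int p)"
    by (intro cong_sum cong_mult cong_pow ab1 cong_refl)
  also have "(\<Sum>i<p. b ^ (p - Suc i) * b ^ i) = (\<Sum>i<p. b ^ q)"
    by (intro sum.cong) (auto simp: Suc simp flip: power_add)
  also have "\<dots> = int p * b ^ q" by simp
  also have "[int p * b ^ q = 0] (mod int p)" by (simp add: cong_0_iff)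
  finally have "int p dvd (\<Sum>i<p. b ^ (p - Suc i) * a ^ i)" by (simp add: cong_0_iff)
  moreover have "int p ^ n dvd a - b" using ab by (simp add: cong_iff_dvd_diff)
  ultimately have "int p ^ n * int p dvd (a - b) * (\<Sum>i<p. b ^ (p - Suc i) * a ^ i)"
    by (rule mult_dvd_mono[rotated])
  then show ?thesis
    by (simp add: cong_iff_dvd_diff power_diff_sumr2 mult.commute)
qed (use ab in simp)

lemma Zp_carrier_iff:
  "x \<in> carrier (Zp p) \<longleftrightarrow> (\<forall>n. 0 \<le> x n \<and> x n < int p ^ n \<and> x (Suc n) mod int p ^ n = x n)"
  by (auto simp: Zp_def)

lemma Zp_mod_self: "x \<in> carrier (Zp p) \<Longrightarrow> x n mod int p ^ n = x n"
  by (simp add: Zp_carrier_iff)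

lemma Zp_ops:
  "(x \<otimes>\<^bsub>Zp p\<^esub> y) n = (x n * y n) mod int p ^ n"
  "(x \<oplus>\<^bsub>Zp p\<^esub> y) n = (x n + y n) mod int p ^ n"
  "\<one>\<^bsub>Zp p\<^esub> n = 1 mod int p ^ n"
  "\<zero>\<^bsub>Zp p\<^esub> n = 0"
  by (simp_all add: Zp_def)

lemma Zp_pow:
  "(x [^]\<^bsub>Zp p\<^esub> (k::nat)) n = x n ^ k mod int p ^ n"
  by (induction k) (simp_all add: Zp_ops mod_simps mult.commute)

lemma Zp_carrierI:
  assumes "p > 0" "\<And>n. [f (Suc n) = f n] (mod int p ^ n)"
  shows "(\<lambda>n. f n mod int p ^ n) \<in> carrier (Zp p)"
  using assms by (auto simp: Zp_carrier_iff cong_def mod_mod_cancel)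

lemma Zp_cong_le:
  assumes x: "x \<in> carrier (Zp p)" and "m \<le> n"
  shows "[x n = x m] (mod int p ^ m)"
  using \<open>m \<le> n\<close>
proof (induction n rule: dec_induct)
  case (step n)
  have "[x (Suc n) = x n] (mod int p ^ n)"
    using x by (simp add: Zp_carrier_iff cong_def)
  then have "[x (Suc n) = x n] (mod int p ^ m)"
    using step.hyps by (auto intro: cong_dvd_modulus le_imp_power_dvd)
  then show ?case using step.IH cong_trans by blast
qed simp

text \<open>A root \<open>x\<close> satisfies \<open>x\<^sup>p = x\<close>, so raising to the \<open>p\<close>-th power improves a congruence between two
  roots without changing them.\<close>

lemma Zp_root_of_unity_unique:
  assumes p: "p > 1"
    and x: "x \<in> carrier (Zp p)" "x [^]\<^bsub>Zp p\<^esub> (p - 1) = \<one>\<^bsub>Zp p\<^esub>"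
    and y: "y \<in> carrier (Zp p)" "y [^]\<^bsub>Zp p\<^esub> (p - 1) = \<one>\<^bsub>Zp p\<^esub>"
    and xy: "x 1 = y 1"
  shows "x = y"
proof
  fix n
  have root: "[z ^ p = z] (mod int p ^ m)" if m: "m \<le> n" "z = w n" and
    w: "w \<in> carrier (Zp p)" "w [^]\<^bsub>Zp p\<^esub> (p - 1) = \<one>\<^bsub>Zp p\<^esub>" for z m w
  proof -
    have "[w n ^ (p - 1) = 1] (mod int p ^ n)"
      using fun_cong[OF w(2), of n] by (simp add: Zp_pow Zp_ops cong_def)
    then have "[w n * w n ^ (p - 1) = w n * 1] (mod int p ^ n)" by (rule cong_scalar_left)
    then have "[z ^ p = z] (mod int p ^ n)"
      using p m by (simp add: power_eq_if)
    then show ?thesis using m(1) by (auto intro: cong_dvd_modulus le_imp_power_dvd)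
  qed
  have "[x n = y n] (mod int p ^ m)" if "m \<le> n" for m
    using that
  proof (induction m)
    case (Suc m)
    show ?case
    proof (cases "m = 0")
      case True
      then show ?thesis
        using Zp_cong_le[OF x(1) Suc.prems] Zp_cong_le[OF y(1) Suc.prems] xy
        by (simp add: cong_def)
    next
      case False
      then have "[x n ^ p = y n ^ p] (mod int p ^ Suc m)"
        using Suc by (intro cong_power_lift) auto
      then show ?thesis
        using root[OF Suc.prems refl x] root[OF Suc.prems refl y] by (meson cong_sym cong_trans)
    qed
  qed simp
  from this[of n] show "x n = y n"
    using Zp_mod_self[OF x(1), of n] Zp_mod_self[OF y(1), of n] by (simp add: cong_def)
qed

text \<open>The root is the limit of \<open>k, k\<^sup>p, (k\<^sup>p)\<^sup>p, \<dots>\<close>.\<close>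

lemma Zp_root_of_unity_exists:
  assumes p: "prime p" and k: "\<not> p dvd k"
  obtains x where "x \<in> carrier (Zp p)" "x [^]\<^bsub>Zp p\<^esub> (p - 1) = \<one>\<^bsub>Zp p\<^esub>"
    "x 1 = int k mod int p"
proof
  define f where "f n = int k ^ p ^ n" for n
  have fermat: "[int k ^ (p - 1) = 1] (mod int p)"
    using fermat_theorem[OF p k] by (simp flip: cong_int_iff)
  have root: "[f n ^ (p - 1) = 1] (mod int p ^ Suc n)" for n
  proof (induction n)
    case 0
    then show ?case using fermat by (simp add: f_def)
  next
    case (Suc n)
    have "[(f n ^ (p - 1)) ^ p = 1 ^ p] (mod int p ^ Suc (Suc n))"
      using Suc by (intro cong_power_lift) auto
    moreover have "(f n ^ (p - 1)) ^ p = f (Suc n) ^ (p - 1)"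
      by (simp add: f_def mult.commute mult.left_commute flip: power_mult)
    ultimately show ?case by simp
  qed
  then have root': "[f n ^ (p - 1) = 1] (mod int p ^ n)" for n
    by (rule cong_dvd_modulus) simp
  have fS: "f (Suc n) = f n * f n ^ (p - 1)" for n
  proof -
    have "f (Suc n) = f n ^ p" by (simp add: f_def mult.commute flip: power_mult)
    then show ?thesis using prime_gt_0_nat[OF p] by (simp add: power_eq_if)
  qed
  show "(\<lambda>n. f n mod int p ^ n) \<in> carrier (Zp p)"
  proof (rule Zp_carrierI)
    fix n
    show "[f (Suc n) = f n] (mod int p ^ n)"
      using cong_scalar_left[OF root'[of n], of "f n"] by (simp add: fS)
  qed (use prime_gt_0_nat[OF p] in simp)
  show "(\<lambda>n. f n mod int p ^ n) [^]\<^bsub>Zp p\<^esub> (p - 1) = \<one>\<^bsub>Zp p\<^esub>"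
    using root' by (simp add: fun_eq_iff Zp_pow Zp_ops mod_simps cong_def)
  show "f 1 mod int p ^ 1 = int k mod int p"
  proof -
    have "[f 0 * f 0 ^ (p - 1) = f 0 * 1] (mod int p)"
      using root[of 0] by (intro cong_scalar_left) simp
    then show ?thesis using fS[of 0] by (simp add: f_def cong_def)
  qed
qed

lemma Zp_nat_multiple: "p > 0 \<Longrightarrow> ([m] \<cdot>\<^bsub>Zp p\<^esub> \<one>\<^bsub>Zp p\<^esub>) n = int m mod int p ^ n"
  by (induction m) (simp_all add: Zp_ops add_pow_def nat_pow_def mod_simps add.commute)

text \<open>The inverse of \<open>p - 1\<close> is minus the geometric series \<open>1 + p + p\<^sup>2 + \<dots>\<close>.\<close>

lemma Zp_pred_Units:
  assumes p: "p > 0"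
  shows "[(p - 1)] \<cdot>\<^bsub>Zp p\<^esub> \<one>\<^bsub>Zp p\<^esub> \<in> Units (Zp p)"
proof -
  interpret cring "Zp p" using p by (rule cring_Zp)
  define f where "f n = - (\<Sum>i<n. int p ^ i)" for n
  have f: "(\<lambda>n. f n mod int p ^ n) \<in> carrier (Zp p)"
    using p by (intro Zp_carrierI) (auto simp: f_def cong_iff_dvd_diff)
  have "(int p - 1) * (\<Sum>i<n. int p ^ i) = int p ^ n - 1" for n
    by (simp add: power_diff_1_eq)
  then have eq: "(int p - 1) * f n = 1 + int p ^ n * (-1)" for n
    by (simp add: f_def)
  have "[(p - 1)] \<cdot>\<^bsub>Zp p\<^esub> \<one>\<^bsub>Zp p\<^esub> \<otimes>\<^bsub>Zp p\<^esub> (\<lambda>n. f n mod int p ^ n) = \<one>\<^bsub>Zp p\<^esub>"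
  proof
    fix n
    have "((int p - 1) * f n) mod int p ^ n = 1 mod int p ^ n"
      unfolding eq by (rule mod_mult_self2)
    then show "([(p - 1)] \<cdot>\<^bsub>Zp p\<^esub> \<one>\<^bsub>Zp p\<^esub> \<otimes>\<^bsub>Zp p\<^esub> (\<lambda>n. f n mod int p ^ n)) n = \<one>\<^bsub>Zp p\<^esub> n"
      using p by (simp add: Zp_ops Zp_nat_multiple mod_simps of_nat_diff)
  qed
  then show ?thesis unfolding Units_def using f m_comm by auto
qed


section \<open>Homomorphisms out of a tensor product\<close>

lemma tensor_group_lift:
  assumes A: "group A" and B: "group B" and G: "comm_group G"
    and closed: "\<And>a b. a \<in> carrier A \<Longrightarrow> b \<in> carrier B \<Longrightarrow> \<beta> a b \<in> carrier G"
    and left: "\<And>a a' b. \<lbrakk>a \<in> carrier A; a' \<in> carrier A; b \<in> carrier B\<rbrakk>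
      \<Longrightarrow> \<beta> (a \<otimes>\<^bsub>A\<^esub> a') b = \<beta> a b \<otimes>\<^bsub>G\<^esub> \<beta> a' b"
    and right: "\<And>a b b'. \<lbrakk>a \<in> carrier A; b \<in> carrier B; b' \<in> carrier B\<rbrakk>
      \<Longrightarrow> \<beta> a (b \<otimes>\<^bsub>B\<^esub> b') = \<beta> a b \<otimes>\<^bsub>G\<^esub> \<beta> a b'"
  obtains \<psi> where "\<psi> \<in> hom (tensor_group A B) G"
    "\<And>a b. a \<in> carrier A \<Longrightarrow> b \<in> carrier B \<Longrightarrow> \<psi> (pure_tensor A B a b) = \<beta> a b"
proof -
  interpret A: group A by (fact A)
  interpret B: group B by (fact B)
  interpret G: comm_group G by (fact G)
  let ?F = "free_Abelian_group (carrier A \<times> carrier B)"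
  have "(\<lambda>(a, b). \<beta> a b) ` (carrier A \<times> carrier B) \<subseteq> carrier G"
    using closed by auto
  then obtain h where h: "h \<in> hom ?F G"
    and h_of: "\<And>x. x \<in> carrier A \<times> carrier B \<Longrightarrow> h (frag_of x) = (\<lambda>(a, b). \<beta> a b) x"
    by (rule G.free_Abelian_group_universal) (rule that)
  interpret h: group_hom ?F G h
    using h by (simp add: group_hom_def group_hom_axioms_def)
  have h_add: "h (x + y) = h x \<otimes>\<^bsub>G\<^esub> h y" if "x \<in> carrier ?F" "y \<in> carrier ?F" for x y
    using h.hom_mult[OF that] by simp
  have kernelI: "x - y - z \<in> kernel ?F G h"
    if "x \<in> carrier ?F" "y \<in> carrier ?F" "z \<in> carrier ?F" "h x = h y \<otimes>\<^bsub>G\<^esub> h z" for x y z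
  proof -
    have c: "x - y - z \<in> carrier ?F"
      using that by (auto dest!: subsetD[OF keys_diff])
    have "h x = h ((x - y - z) + (y + z))" by simp
    also have "\<dots> = h (x - y - z) \<otimes>\<^bsub>G\<^esub> h (y + z)"
      by (rule h_add[OF c]) (use that in \<open>auto dest!: subsetD[OF keys_add]\<close>)
    also have "h (y + z) = h x" using that by (simp add: h_add)
    finally show ?thesis
      using c that(1) by (simp add: kernel_def G.r_cancel_one')
  qed
  have kernel: "tensor_rel A B \<subseteq> kernel ?F G h"
    unfolding tensor_rel_def
  proof (rule group.generate_subgroup_incl)
    show "subgroup (kernel ?F G h) ?F" by (rule h.subgroup_kernel)
    show "{frag_of (a \<otimes>\<^bsub>A\<^esub> a', b) - frag_of (a, b) - frag_of (a', b) | a a' b.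
         a \<in> carrier A \<and> a' \<in> carrier A \<and> b \<in> carrier B}
      \<union> {frag_of (a, b \<otimes>\<^bsub>B\<^esub> b') - frag_of (a, b) - frag_of (a, b') | a b b'.
         a \<in> carrier A \<and> b \<in> carrier B \<and> b' \<in> carrier B} \<subseteq> kernel ?F G h"
      by (auto intro!: kernelI simp: h_of left right)
  qed simp
  have normal: "tensor_rel A B \<lhd> ?F"
    using tensor_rel_subgroup[OF A B] abelian_free_Abelian_group comm_group.normal_iff_subgroup by blast
  obtain \<psi> where \<psi>: "\<psi> \<in> hom (?F Mod tensor_rel A B) G"
    and eq: "\<And>x. x \<in> carrier ?F \<Longrightarrow> \<psi> (tensor_rel A B #>\<^bsub>?F\<^esub> x) = h x"
    using h.FactGroup_universal_kernel[OF normal kernel] by blast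
  show ?thesis
  proof (rule that)
    show "\<psi> \<in> hom (tensor_group A B) G" using \<psi> by (simp add: tensor_group_def)
    show "\<psi> (pure_tensor A B a b) = \<beta> a b" if "a \<in> carrier A" "b \<in> carrier B" for a b
      using that by (simp add: pure_tensor_def eq h_of)
  qed
qed

lemma pure_tensor_closed:
  assumes "a \<in> carrier A" "b \<in> carrier B"
  shows "pure_tensor A B a b \<in> carrier (tensor_group A B)"
  using assms by (auto simp: pure_tensor_def tensor_group_def FactGroup_def RCOSETS_def)

lemma hom_integer_mod_finprod:
  assumes G: "comm_group G" and \<psi>: "\<psi> \<in> hom G (integer_mod_group n)"
    and f: "f \<in> A \<rightarrow> carrier G" and A: "finite A"
  shows "\<psi> (finprod G f A) = (\<Sum>a\<in>A. \<psi> (f a)) mod int n"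
proof -
  interpret comm_group G by (fact G)
  interpret h: group_hom G "integer_mod_group n" \<psi>
    using \<psi> by (simp add: group_hom_def group_hom_axioms_def)
  show ?thesis using A f
    by (induction A) (use h.hom_one in \<open>simp_all add: h.hom_mult Pi_iff mod_simps\<close>)
qed

section \<open>Order of vanishing of a rational function\<close>

text \<open>The order does not depend on the chosen fraction; that of the zero function is left unspecified,
  since no fraction with a nonzero numerator represents it.\<close>

definition ratfun_order :: "'k::field \<Rightarrow> 'k ratfun \<Rightarrow> int" where
  "ratfun_order \<alpha> r = (THE n. \<exists>f g. f \<noteq> 0 \<and> g \<noteq> 0 \<and> r = Fract f g
     \<and> n = int (order \<alpha> f) - int (order \<alpha> g))"

lemma ratfun_order_Fract:
  assumes "f \<noteq> 0" "g \<noteq> 0"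
  shows "ratfun_order \<alpha> (Fract f g) = int (order \<alpha> f) - int (order \<alpha> g)"
  unfolding ratfun_order_def
proof (rule the_equality)
  fix n
  assume "\<exists>f' g'. f' \<noteq> 0 \<and> g' \<noteq> 0 \<and> Fract f g = Fract f' g'
    \<and> n = int (order \<alpha> f') - int (order \<alpha> g')"
  then obtain f' g' where *: "f' \<noteq> 0" "g' \<noteq> 0" "Fract f g = Fract f' g'"
    "n = int (order \<alpha> f') - int (order \<alpha> g')" by blast
  then have "f * g' = f' * g" using assms by (simp add: eq_fract)
  then have "order \<alpha> f + order \<alpha> g' = order \<alpha> f' + order \<alpha> g"
    using assms * by (metis order_mult mult_eq_0_iff)
  then show "n = int (order \<alpha> f) - int (order \<alpha> g)" using * by simp
qed (use assms in blast)

lemma ratfun_order_mult: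
  assumes "r \<noteq> 0" "s \<noteq> 0"
  shows "ratfun_order \<alpha> (r * s) = ratfun_order \<alpha> r + ratfun_order \<alpha> s"
proof -
  obtain f g where r: "r = Fract f g" "g \<noteq> 0" by (cases r) auto
  obtain f' g' where s: "s = Fract f' g'" "g' \<noteq> 0" by (cases s) auto
  have "f \<noteq> 0" "f' \<noteq> 0" using assms r s by (auto simp: fract_collapse)
  then show ?thesis using r s by (simp add: ratfun_order_Fract order_mult)
qed

lemma order_linear:
  fixes f :: "'a::field poly"
  assumes "f \<noteq> 0" "degree f \<le> 1"
  shows "order \<alpha> f = (if poly f \<alpha> = 0 then 1 else 0)"
  using order_degree[of f \<alpha>] order_root[of f \<alpha>] assms by auto

lemma group_ratfun_units: "group (ratfun_units :: 'k::field ratfun monoid)"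
proof (rule groupI)
  fix r :: "'k ratfun"
  assume "r \<in> carrier ratfun_units"
  then show "\<exists>s\<in>carrier ratfun_units. s \<otimes>\<^bsub>ratfun_units\<^esub> r = \<one>\<^bsub>ratfun_units\<^esub>"
    by (intro bexI[of _ "inverse r"]) (auto simp: ratfun_units_def)
qed (auto simp: ratfun_units_def mult.assoc)

lemma ratfun_map_Fract_hom:
  assumes "field_aut s" "g \<noteq> 0"
  shows "ratfun_map s (Fract f g) = Fract (map_poly s f) (map_poly s g)"
  using assms by (intro ratfun_map_Fract) (auto simp: field_aut_def)

lemma ratfun_map_hom:
  fixes s :: "'k::field \<Rightarrow> 'k"
  assumes s: "field_aut s"
  shows "ratfun_map s \<in> hom ratfun_units ratfun_units"
proof -
  have zero: "s 0 = 0"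
    using s unfolding field_aut_def by (metis add_0 add_cancel_right_left)
  have nz: "s x \<noteq> 0" if "x \<noteq> 0" for x
    using s that zero unfolding field_aut_def bij_def by (metis injD)
  have map_nz: "map_poly s f \<noteq> 0" if "f \<noteq> 0" for f
    using that nz zero by (subst map_poly_eq_0_iff) auto
  have map_mult: "map_poly s (f * g) = map_poly s f * map_poly s g" for f g
    using s zero by (intro map_poly_hom_mult) (auto simp: field_aut_def)
  show ?thesis
  proof (rule homI)
    fix r :: "'k ratfun"
    assume "r \<in> carrier ratfun_units"
    moreover obtain f g where r: "r = Fract f g" "g \<noteq> 0" by (cases r) auto
    ultimately have "f \<noteq> 0" by (auto simp: ratfun_units_def fract_collapse)
    with r show "ratfun_map s r \<in> carrier ratfun_units"
      using map_nz by (simp add: ratfun_units_def ratfun_map_Fract_hom[OF s] Zero_fract_def eq_fract)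
  next
    fix r r' :: "'k ratfun"
    obtain f g where r: "r = Fract f g" "g \<noteq> 0" by (cases r) auto
    obtain f' g' where r': "r' = Fract f' g'" "g' \<noteq> 0" by (cases r') auto
    show "ratfun_map s (r \<otimes>\<^bsub>ratfun_units\<^esub> r') = ratfun_map s r \<otimes>\<^bsub>ratfun_units\<^esub> ratfun_map s r'"
      using r r' by (simp add: ratfun_units_def ratfun_map_Fract_hom[OF s] map_mult)
  qed
qed


section \<open>The Galois group and the idempotent\<close>

locale cyclotomic_field =
  fixes p :: nat and \<zeta> :: "'k::field_char_0"
  assumes prime: "prime p" and gt3: "p > 3"
    and primitive: "primitive_root_of_unity p \<zeta>"
    and generates: "rat_adjoin \<zeta> = (UNIV :: 'k set)"
begin

lemma zeta_power_p: "\<zeta> ^ p = 1"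
  using primitive by (simp add: primitive_root_of_unity_def)

lemma zeta_nonzero: "\<zeta> \<noteq> 0"
  using zeta_power_p gt3 by (metis power_0_left zero_neq_one not_less0)

lemma zeta_power_mod: "\<zeta> ^ (k mod p) = \<zeta> ^ k"
proof -
  have "\<zeta> ^ k = \<zeta> ^ (p * (k div p) + k mod p)" by simp
  also have "\<dots> = \<zeta> ^ (k mod p)" by (simp only: power_add power_mult zeta_power_p power_one mult_1)
  finally show ?thesis by simp
qed

lemma zeta_power_inj: "inj_on (\<lambda>k. \<zeta> ^ k) {..<p}"
proof (rule linorder_inj_onI)
  fix i j assume ij: "i < j" "i \<in> {..<p}" "j \<in> {..<p}"
  show "\<zeta> ^ i \<noteq> \<zeta> ^ j"
  proof
    assume "\<zeta> ^ i = \<zeta> ^ j"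
    moreover have "\<zeta> ^ j = \<zeta> ^ i * \<zeta> ^ (j - i)" using ij by (simp flip: power_add)
    ultimately have "\<zeta> ^ (j - i) = 1" using zeta_nonzero by simp
    then show False using primitive ij by (auto simp: primitive_root_of_unity_def)
  qed
qed auto

lemma zeta_power_eq_iff: "\<zeta> ^ i = \<zeta> ^ j \<longleftrightarrow> [i = j] (mod p)"
proof
  assume "\<zeta> ^ i = \<zeta> ^ j"
  then have "\<zeta> ^ (i mod p) = \<zeta> ^ (j mod p)" by (simp add: zeta_power_mod)
  then show "[i = j] (mod p)"
    using inj_onD[OF zeta_power_inj, of "i mod p" "j mod p"] gt3 by (simp add: cong_def)
next
  assume "[i = j] (mod p)"
  then show "\<zeta> ^ i = \<zeta> ^ j" by (metis cong_def zeta_power_mod)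
qed

text \<open>The powers of \<open>\<zeta>\<close> are already \<open>p\<close> roots of \<open>X\<^sup>p - 1\<close>, so a degree count leaves no room
  for others.\<close>

lemma roots_of_unity: "{x. x ^ p = (1 :: 'k)} = (\<lambda>k. \<zeta> ^ k) ` {..<p}"
proof -
  define P where "P = monom (1 :: 'k) p - 1"
  have P: "coeff P p = 1" using gt3 by (simp add: P_def)
  then have "P \<noteq> 0" by auto
  have "degree P \<le> p" unfolding P_def by (intro degree_diff_le) (auto simp: degree_monom_eq)
  have roots: "{x. poly P x = 0} = {x. x ^ p = 1}" by (simp add: P_def poly_monom)
  have "(\<lambda>k. \<zeta> ^ k) ` {..<p} = {x. x ^ p = 1}"
  proof (rule card_seteq)
    show "finite {x. x ^ p = (1 :: 'k)}"
      unfolding roots[symmetric] using \<open>P \<noteq> 0\<close> by (rule poly_roots_finite)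
    show "(\<lambda>k. \<zeta> ^ k) ` {..<p} \<subseteq> {x. x ^ p = 1}"
      by (auto simp: power_commutes power_mult[symmetric] mult.commute[of _ p])
        (simp add: power_mult zeta_power_p)
    have "card {x. x ^ p = (1 :: 'k)} \<le> degree P"
      unfolding roots[symmetric] using \<open>P \<noteq> 0\<close> by (rule card_poly_roots_bound)
    also have "\<dots> \<le> card ((\<lambda>k. \<zeta> ^ k) ` {..<p})"
      using \<open>degree P \<le> p\<close> by (simp add: card_image[OF zeta_power_inj])
    finally show "card {x. x ^ p = (1 :: 'k)} \<le> card ((\<lambda>k. \<zeta> ^ k) ` {..<p})" .
  qed
  then show ?thesis by simp
qed

lemma galQ_field_aut: "s \<in> galQ \<Longrightarrow> field_aut s"
  and galQ_of_rat: "s \<in> galQ \<Longrightarrow> s (of_rat q) = of_rat q"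
  by (auto simp: galQ_def)

lemma id_in_galQ: "id \<in> galQ"
  by (simp add: galQ_def field_aut_def)

lemma galQ_zeta:
  assumes s: "s \<in> galQ"
  obtains k where "s \<zeta> = \<zeta> ^ k" "\<not> p dvd k"
proof -
  note hom = field_aut_simps[OF galQ_field_aut[OF s]]
  have "s \<zeta> ^ p = 1" using hom(5)[of \<zeta> p] by (simp add: zeta_power_p hom(2))
  then obtain k where k: "s \<zeta> = \<zeta> ^ k" using roots_of_unity by blast
  moreover have "\<not> p dvd k"
  proof
    assume "p dvd k"
    then have "\<zeta> ^ k = \<zeta> ^ 0" by (simp only: zeta_power_eq_iff) (simp add: cong_0_iff)
    then have "s \<zeta> = s 1" using k by (simp add: hom(2))
    then have "\<zeta> ^ 1 = \<zeta> ^ 0" by (simp add: hom(11))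
    then have "[1 = 0 :: nat] (mod p)" by (simp only: zeta_power_eq_iff)
    then show False using gt3 by (simp add: cong_def)
  qed
  ultimately show ?thesis by (rule that)
qed

text \<open>Two automorphisms agree on a subfield; if it contains \<open>\<zeta>\<close>, it is everything.\<close>

lemma galQ_eqI:
  assumes s: "s \<in> galQ" and t: "t \<in> galQ" and eq: "s \<zeta> = t \<zeta>"
  shows "s = t"
proof -
  note hs = field_aut_simps[OF galQ_field_aut[OF s]] and ht = field_aut_simps[OF galQ_field_aut[OF t]]
  have "is_subfield {x. s x = t x}"
    by (auto simp: is_subfield_def hs(1-4,7) ht(1-4,7) inverse_eq_divide hs(9) ht(9))
  then have "rat_adjoin \<zeta> \<subseteq> {x. s x = t x}"
    unfolding rat_adjoin_def using eq by (intro Inter_lower) simp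
  then show ?thesis using generates by auto
qed

text \<open>Finiteness matters because a \<open>finprod\<close> over an infinite index set is the neutral element by
  default, which would empty the relation of its content.\<close>

lemma finite_galQ: "finite (galQ :: ('k \<Rightarrow> 'k) set)"
proof (rule finite_imageD)
  show "inj_on (\<lambda>s. s \<zeta>) galQ" by (rule inj_onI) (rule galQ_eqI)
  have "(\<lambda>s. s \<zeta>) ` galQ \<subseteq> (\<lambda>k. \<zeta> ^ k) ` {..<p}"
  proof safe
    fix s :: "'k \<Rightarrow> 'k" assume "s \<in> galQ"
    then obtain k where "s \<zeta> = \<zeta> ^ (k mod p)" using galQ_zeta zeta_power_mod by metis
    then show "s \<zeta> \<in> (\<lambda>k. \<zeta> ^ k) ` {..<p}" using gt3 by auto
  qed
  then show "finite ((\<lambda>s. s \<zeta>) ` galQ)" by (rule finite_subset) simp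
qed

text \<open>Both \<open>k\<close> modulo \<open>p\<close> and the Teichmueller lift of a residue are unique, so the definite
  description in the definition of the character denotes what it should.\<close>

lemma teichmueller_char_root:
  assumes s: "s \<in> galQ" and k: "s \<zeta> = \<zeta> ^ k"
  shows "teichmueller_char p \<zeta> s \<in> carrier (Zp p)"
    and "teichmueller_char p \<zeta> s [^]\<^bsub>Zp p\<^esub> (p - 1) = \<one>\<^bsub>Zp p\<^esub>"
    and "teichmueller_char p \<zeta> s 1 = int k mod int p"
proof -
  let ?root = "\<lambda>x. x \<in> carrier (Zp p) \<and> x [^]\<^bsub>Zp p\<^esub> (p - 1) = \<one>\<^bsub>Zp p\<^esub>
     \<and> (\<exists>k::nat. s \<zeta> = \<zeta> ^ k \<and> x 1 = int k mod int p)"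
  have residue: "int j mod int p = int k mod int p" if "s \<zeta> = \<zeta> ^ j" for j
    using that k zeta_power_eq_iff[of j k] by (simp add: cong_def flip: of_nat_mod)
  obtain j where "s \<zeta> = \<zeta> ^ j" "\<not> p dvd j" using galQ_zeta[OF s] .
  moreover from Zp_root_of_unity_exists[OF prime this(2)] obtain x where
    "x \<in> carrier (Zp p)" "x [^]\<^bsub>Zp p\<^esub> (p - 1) = \<one>\<^bsub>Zp p\<^esub>" "x 1 = int j mod int p" .
  ultimately have "?root x" by blast
  moreover have "y = x" if "?root y" for y
    using that \<open>?root x\<close> residue Zp_root_of_unity_unique[of p y x] gt3 by force
  ultimately have "?root (teichmueller_char p \<zeta> s)"
    unfolding teichmueller_char_def by (rule theI)
  then show "teichmueller_char p \<zeta> s \<in> carrier (Zp p)"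
    "teichmueller_char p \<zeta> s [^]\<^bsub>Zp p\<^esub> (p - 1) = \<one>\<^bsub>Zp p\<^esub>"
    "teichmueller_char p \<zeta> s 1 = int k mod int p"
    using residue by auto
qed

text \<open>Modulo \<open>p\<close>, the factor \<open>1 / (p - 1)\<close> is \<open>- 1\<close> and \<open>\<omega>(s)\<close> is \<open>k\<close>, so the coefficient of \<open>s\<close>
  in the idempotent is \<open>- 1 / k\<close>. This residue is all that survives modulo \<open>p\<close>-th powers.\<close>

lemma eps_omega_residue:
  assumes s: "s \<in> galQ"
  shows "eps_omega p \<zeta> s \<in> carrier (Zp p)"
    and "s \<zeta> = \<zeta> ^ k \<Longrightarrow> [eps_omega p \<zeta> s 1 * int k = - 1] (mod int p)"
proof -
  interpret Z: cring "Zp p" using gt3 by (intro cring_Zp) simp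
  define e where "e = [(p - 1)] \<cdot>\<^bsub>Zp p\<^esub> \<one>\<^bsub>Zp p\<^esub>"
  define t where "t = teichmueller_char p \<zeta> s"
  have e: "e \<in> Units (Zp p)" unfolding e_def using gt3 by (intro Zp_pred_Units) simp
  obtain j where j: "s \<zeta> = \<zeta> ^ j" using galQ_zeta[OF s] by metis
  have t: "t \<in> Units (Zp p)"
  proof -
    note root = teichmueller_char_root(1,2)[OF s j, folded t_def]
    have "p - 1 = Suc (p - 2)" using gt3 by simp
    then have "t [^]\<^bsub>Zp p\<^esub> (p - 2) \<otimes>\<^bsub>Zp p\<^esub> t = \<one>\<^bsub>Zp p\<^esub>"
      using root by (metis Z.nat_pow_Suc)
    moreover from this have "t \<otimes>\<^bsub>Zp p\<^esub> t [^]\<^bsub>Zp p\<^esub> (p - 2) = \<one>\<^bsub>Zp p\<^esub>"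
      using Z.m_comm[OF root(1) Z.nat_pow_closed[OF root(1)]] by metis
    ultimately show ?thesis
      unfolding Units_def using root(1) Z.nat_pow_closed[OF root(1), of "p - 2"] by blast
  qed
  have eps: "eps_omega p \<zeta> s = inv\<^bsub>Zp p\<^esub> e \<otimes>\<^bsub>Zp p\<^esub> inv\<^bsub>Zp p\<^esub> t"
    by (simp add: eps_omega_def e_def t_def)
  show closed: "eps_omega p \<zeta> s \<in> carrier (Zp p)" unfolding eps using e t by simp
  assume k: "s \<zeta> = \<zeta> ^ k"
  have "eps_omega p \<zeta> s \<otimes>\<^bsub>Zp p\<^esub> (e \<otimes>\<^bsub>Zp p\<^esub> t) = \<one>\<^bsub>Zp p\<^esub>"
  proof -
    have "eps_omega p \<zeta> s \<otimes>\<^bsub>Zp p\<^esub> (e \<otimes>\<^bsub>Zp p\<^esub> t)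
        = (inv\<^bsub>Zp p\<^esub> e \<otimes>\<^bsub>Zp p\<^esub> e) \<otimes>\<^bsub>Zp p\<^esub> (inv\<^bsub>Zp p\<^esub> t \<otimes>\<^bsub>Zp p\<^esub> t)"
      unfolding eps using e t by (simp add: Z.m_ac Z.Units_closed del: Z.Units_l_inv Z.Units_r_inv)
    then show ?thesis using e t by simp
  qed
  then have "(eps_omega p \<zeta> s \<otimes>\<^bsub>Zp p\<^esub> (e \<otimes>\<^bsub>Zp p\<^esub> t)) 1 = 1 mod int p" by (simp add: Zp_ops)
  then have "[eps_omega p \<zeta> s 1 * (e 1 * t 1) = 1] (mod int p)"
    by (simp add: Zp_ops cong_def mod_mult_right_eq)
  moreover have "[t 1 = int k] (mod int p)"
    using teichmueller_char_root(3)[OF s k] by (simp add: t_def cong_def)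
  moreover have "e 1 = (int p - 1) mod int p"
    using gt3 by (simp add: e_def Zp_nat_multiple of_nat_diff)
  then have "[e 1 = - 1] (mod int p)" by (simp add: cong_def)
  ultimately have "[eps_omega p \<zeta> s 1 * (- 1 * int k) = 1] (mod int p)"
    by (meson cong_mult cong_refl cong_sym cong_trans)
  then have "[- (eps_omega p \<zeta> s 1 * (- 1 * int k)) = - 1] (mod int p)"
    by (simp only: cong_minus_minus_iff)
  then show "[eps_omega p \<zeta> s 1 * int k = - 1] (mod int p)" by simp
qed

section \<open>The order of vanishing on the tensor product\<close>

text \<open>The order at \<open>\<alpha>\<close>, extended linearly to the \<open>p\<close>-adic tensor product and reduced modulo \<open>p\<close>,
  takes values in a group of exponent \<open>p\<close> and is therefore blind to \<open>p\<close>-th powers.\<close>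

lemma Mmod_order_char:
  fixes \<alpha> :: 'k
  obtains \<psi> where "\<psi> \<in> hom (Mmod p) (integer_mod_group p)"
    "\<And>c r. c \<in> carrier (Zp p) \<Longrightarrow> r \<noteq> 0 \<Longrightarrow>
       \<psi> (pure_tensor (add_monoid (Zp p)) ratfun_units c r) = (c 1 * ratfun_order \<alpha> r) mod int p"
proof -
  interpret Z: cring "Zp p" using gt3 by (intro cring_Zp) simp
  have "group (add_monoid (Zp p))" by (rule Z.add.is_group)
  then obtain \<psi> where "\<psi> \<in> hom (Mmod p) (integer_mod_group p)"
    "\<And>c r. c \<in> carrier (add_monoid (Zp p)) \<Longrightarrow> r \<in> carrier ratfun_units \<Longrightarrow>
       \<psi> (pure_tensor (add_monoid (Zp p)) ratfun_units c r) = (c 1 * ratfun_order \<alpha> r) mod int p"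
    by (rule tensor_group_lift[OF _ group_ratfun_units abelian_integer_mod_group,
          of _ "\<lambda>c r. (c 1 * ratfun_order \<alpha> r) mod int p" p])
      (use gt3 in \<open>auto simp: carrier_integer_mod_group ratfun_units_def Zp_ops ratfun_order_mult
        algebra_simps mod_simps\<close>)
  then show ?thesis by (intro that) (auto simp: ratfun_units_def)
qed

lemma Mexp_Memb:
  fixes r :: "'k ratfun"
  assumes r: "r \<noteq> 0" and \<theta>: "\<And>s. s \<in> galQ \<Longrightarrow> \<theta> s \<in> carrier (Zp p)"
  shows "Mexp p (Memb p r) \<theta> =
      (\<Otimes>\<^bsub>Mmod p\<^esub>s\<in>galQ. pure_tensor (add_monoid (Zp p)) ratfun_units (\<theta> s) (ratfun_map s r))"
    and "\<And>s. s \<in> galQ \<Longrightarrow> ratfun_map s r \<noteq> 0"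
proof -
  interpret Z: cring "Zp p" using gt3 by (intro cring_Zp) simp
  have units: "r \<in> carrier ratfun_units" using r by (simp add: ratfun_units_def)
  show nz: "ratfun_map s r \<noteq> 0" if "s \<in> galQ" for s
    using hom_in_carrier[OF ratfun_map_hom[OF galQ_field_aut[OF that]] units]
    by (simp add: ratfun_units_def)
  have M: "comm_group (Mmod p :: ((nat \<Rightarrow> int) \<times> 'k ratfun \<Rightarrow>\<^sub>0 int) set monoid)"
    by (rule comm_group_tensor_group[OF Z.add.is_group group_ratfun_units])
  have "tensor_map (add_monoid (Zp p)) ratfun_units (\<lambda>c. \<theta> s \<otimes>\<^bsub>Zp p\<^esub> c) (ratfun_map s) (Memb p r)
      = pure_tensor (add_monoid (Zp p)) ratfun_units (\<theta> s) (ratfun_map s r)" if s: "s \<in> galQ" for s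
  proof -
    have "(\<lambda>c. \<theta> s \<otimes>\<^bsub>Zp p\<^esub> c) \<in> hom (add_monoid (Zp p)) (add_monoid (Zp p))"
      using \<theta>[OF s] by (intro homI) (auto simp: Z.r_distr)
    from tensor_map_pure[OF Z.add.is_group group_ratfun_units Z.add.is_group group_ratfun_units
        this ratfun_map_hom[OF galQ_field_aut[OF s]], of "\<one>\<^bsub>Zp p\<^esub>" r]
    show ?thesis using \<theta>[OF s] units by simp
  qed
  then show "Mexp p (Memb p r) \<theta> =
      (\<Otimes>\<^bsub>Mmod p\<^esub>s\<in>galQ. pure_tensor (add_monoid (Zp p)) ratfun_units (\<theta> s) (ratfun_map s r))"
    unfolding Mexp_def using \<theta> nz
    by (intro comm_monoid.finprod_cong'[OF comm_group.axioms(1)[OF M]])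
      (auto intro!: pure_tensor_closed simp: ratfun_units_def)
qed

section \<open>Comparing the two sides\<close>

lemma rational_power_relation:
  assumes L: "0 < L" "L < p" and eq: "of_rat d * \<zeta> ^ L = (of_rat c :: 'k)"
  shows "c = 0 \<and> d = 0"
  using four_term_relation[OF prime gt3 primitive L, of d 0 c 0] eq gt3 by auto

lemma moebius_pullback:
  fixes x :: 'k
  assumes D: "[:d, c:] \<noteq> 0"
  shows "1 + ratfun_map of_rat (Fract [:b, a:] [:d, c:]) * ratfun_const x
    = Fract [:of_rat d + of_rat b * x, of_rat c + of_rat a * x:] [:of_rat d, of_rat c:]"
proof -
  have D': "[:of_rat d, of_rat c :: 'k:] \<noteq> 0" using D by auto
  have "ratfun_map of_rat (Fract [:b, a:] [:d, c:])
      = Fract [:of_rat b, of_rat a :: 'k:] [:of_rat d, of_rat c:]"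
    using D by (subst ratfun_map_Fract) (auto simp: of_rat_add of_rat_mult map_poly_pCons)
  then show ?thesis
    using D' by (simp add: ratfun_const_def One_fract_def algebra_simps)
qed

text \<open>Away from the pole, applying \<open>s\<close> to \<open>1 + T(Y) x\<close> for a Moebius \<open>T\<close> gives a function whose
  numerator is linear, so its order at \<open>\<alpha>\<close> is 1 or 0. The exponent \<open>\<epsilon>\<close> then adds up the residues of
  its coefficients over those \<open>s\<close> for which \<open>\<alpha>\<close> is a zero. With \<open>(a, b, c, d) = (1, 0, 0, 1)\<close> this
  also covers the right-hand side of the relation.\<close>

lemma order_char_moebius:
  fixes \<alpha> x :: 'k
  assumes \<psi>: "\<psi> \<in> hom (Mmod p) (integer_mod_group p)"
    and \<psi>_pure: "\<And>c r. c \<in> carrier (Zp p) \<Longrightarrow> r \<noteq> 0 \<Longrightarrow>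
       \<psi> (pure_tensor (add_monoid (Zp p)) ratfun_units c r) = (c 1 * ratfun_order \<alpha> r) mod int p"
    and D: "[:d, c:] \<noteq> 0" "of_rat d + of_rat c * \<alpha> \<noteq> 0"
    and N: "of_rat d + of_rat b * x \<noteq> 0 \<or> of_rat c + of_rat a * x \<noteq> 0"
  defines "m \<equiv> Mexp p (Memb p (1 + ratfun_map of_rat (Fract [:b, a:] [:d, c:]) * ratfun_const x))
      (eps_omega p \<zeta>)"
  shows "m \<in> carrier (Mmod p)"
    and "\<psi> m = (\<Sum>s\<in>{s \<in> galQ. (of_rat d + of_rat c * \<alpha>) + (of_rat b + of_rat a * \<alpha>) * s x = 0}.
      eps_omega p \<zeta> s 1) mod int p"
proof -
  interpret Z: cring "Zp p" using gt3 by (intro cring_Zp) simp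
  interpret M: comm_group "Mmod p :: ((nat \<Rightarrow> int) \<times> 'k ratfun \<Rightarrow>\<^sub>0 int) set monoid"
    by (rule comm_group_tensor_group[OF Z.add.is_group group_ratfun_units])
  define r where "r = 1 + ratfun_map of_rat (Fract [:b, a:] [:d, c:]) * ratfun_const x"
  have r: "r = Fract [:of_rat d + of_rat b * x, of_rat c + of_rat a * x:] [:of_rat d, of_rat c:]"
    unfolding r_def by (rule moebius_pullback[OF D(1)])
  have D': "[:of_rat d, of_rat c :: 'k:] \<noteq> 0" using D(1) by auto
  have "r \<noteq> 0" unfolding r using N D' by (auto simp: Zero_fract_def eq_fract)
  note mexp = Mexp_Memb[OF this eps_omega_residue(1)]
  have closed: "(\<lambda>s. pure_tensor (add_monoid (Zp p)) ratfun_units (eps_omega p \<zeta> s) (ratfun_map s r))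
      \<in> galQ \<rightarrow> carrier (Mmod p)"
    using mexp(2) eps_omega_residue(1) by (auto intro!: pure_tensor_closed simp: ratfun_units_def)
  have m: "m = (\<Otimes>\<^bsub>Mmod p\<^esub>s\<in>galQ.
      pure_tensor (add_monoid (Zp p)) ratfun_units (eps_omega p \<zeta> s) (ratfun_map s r))"
    unfolding m_def r_def[symmetric] by (rule mexp(1))
  show "m \<in> carrier (Mmod p)" unfolding m by (rule M.finprod_closed[OF closed])
  let ?v = "\<lambda>s. if (of_rat d + of_rat c * \<alpha>) + (of_rat b + of_rat a * \<alpha>) * s x = 0 then 1 else 0 :: int"
  have order: "ratfun_order \<alpha> (ratfun_map s r) = ?v s" if s: "s \<in> galQ" for s
  proof -
    note hom = field_aut_simps[OF galQ_field_aut[OF s]] galQ_of_rat[OF s]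
    let ?N = "[:of_rat d + of_rat b * s x, of_rat c + of_rat a * s x:]"
    have eq: "ratfun_map s r = Fract ?N [:of_rat d, of_rat c:]"
      unfolding r using D' by (simp add: ratfun_map_Fract_hom[OF galQ_field_aut[OF s]] map_poly_pCons hom)
    have "s (of_rat d + of_rat b * x) \<noteq> 0 \<or> s (of_rat c + of_rat a * x) \<noteq> 0"
      using N by (simp only: hom(12) simp_thms)
    then have N': "?N \<noteq> 0" by (simp add: hom)
    have "order \<alpha> [:of_rat d, of_rat c:] = 0"
      using D(2) by (intro order_0I) (simp add: mult.commute)
    moreover have poly_N: "poly ?N \<alpha> = (of_rat d + of_rat c * \<alpha>) + (of_rat b + of_rat a * \<alpha>) * s x"
      by (simp add: algebra_simps)
    have "int (order \<alpha> ?N) = ?v s"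
      unfolding poly_N[symmetric] using N' by (subst order_linear) auto
    ultimately show ?thesis unfolding eq ratfun_order_Fract[OF N' D'] by simp
  qed
  have "\<psi> m = (\<Sum>s\<in>galQ. (eps_omega p \<zeta> s 1 * ratfun_order \<alpha> (ratfun_map s r)) mod int p) mod int p"
    unfolding m hom_integer_mod_finprod[OF M.comm_group_axioms \<psi> closed finite_galQ]
    by (intro arg_cong2[of _ _ _ _ "(mod)"] sum.cong refl \<psi>_pure eps_omega_residue(1) mexp(2))
  also have "\<dots> = (\<Sum>s\<in>galQ. eps_omega p \<zeta> s 1 * ?v s) mod int p"
    by (simp add: mod_sum_eq order)
  also have "(\<Sum>s\<in>galQ. eps_omega p \<zeta> s 1 * ?v s) =
      (\<Sum>s\<in>{s \<in> galQ. (of_rat d + of_rat c * \<alpha>) + (of_rat b + of_rat a * \<alpha>) * s x = 0}.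
        eps_omega p \<zeta> s 1)"
    by (simp add: sum.inter_filter[OF finite_galQ] if_distrib cong: if_cong)
  finally show "\<psi> m = (\<Sum>s\<in>{s \<in> galQ. (of_rat d + of_rat c * \<alpha>) + (of_rat b + of_rat a * \<alpha>) * s x = 0}.
      eps_omega p \<zeta> s 1) mod int p" .
qed

lemma eps_omega_residue_inj:
  assumes s: "s \<in> galQ" "t \<in> galQ"
    and eq: "[eps_omega p \<zeta> s 1 = eps_omega p \<zeta> t 1] (mod int p)"
  shows "s = t"
proof -
  obtain j where j: "s \<zeta> = \<zeta> ^ j" "\<not> p dvd j" by (rule galQ_zeta[OF s(1)])
  obtain k where k: "t \<zeta> = \<zeta> ^ k" by (rule galQ_zeta[OF s(2)])
  let ?e = "eps_omega p \<zeta> t 1"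
  have es: "[eps_omega p \<zeta> s 1 * int j = - 1] (mod int p)" by (rule eps_omega_residue(2)[OF s(1) j(1)])
  have et: "[?e * int k = - 1] (mod int p)" by (rule eps_omega_residue(2)[OF s(2) k])
  have "[?e * int j = ?e * int k] (mod int p)"
    using es et cong_scalar_right[OF eq, of "int j"] by (meson cong_sym cong_trans)
  moreover have "coprime ?e (int p)"
  proof -
    have "\<not> int p dvd ?e"
    proof
      assume "int p dvd ?e"
      then have "[?e * int k = 0] (mod int p)" by (simp add: cong_0_iff)
      with et have "[- 1 = 0] (mod int p)" by (meson cong_sym cong_trans)
      then show False using gt3 by (simp add: cong_0_iff)
    qed
    then show ?thesis using prime by (metis coprime_commute prime_imp_coprime prime_nat_int_transfer)
  qed
  ultimately have "[int j = int k] (mod int p)" by (simp add: cong_mult_lcancel)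
  then have "s \<zeta> = t \<zeta>" by (simp add: j k zeta_power_eq_iff cong_int_iff)
  then show ?thesis by (rule galQ_eqI[OF s])
qed

text \<open>The comparison takes place at \<open>\<alpha> = - 1 / \<zeta>\<^sup>l\<close>, the zero of \<open>1 + Y \<zeta>\<^sup>l\<close>. On the right only the
  identity of the Galois group contributes. On the left at most one \<open>s\<close> does, and equality of
  residues forces it to be the identity. Hence \<open>\<alpha>\<close> is a zero of \<open>1 + T(Y) \<zeta>\<close>, which is a relation
  between four powers of \<open>\<zeta>\<close>.\<close>

theorem only_trivial_twists:
  fixes T :: "rat ratfun \<Rightarrow> rat ratfun" and l m :: int
  assumes T: "field_aut T" and l: "\<not> int p dvd l"
    and u: "u \<in> carrier (Mmod p :: ((nat \<Rightarrow> int) \<times> 'k ratfun \<Rightarrow>\<^sub>0 int) set monoid)"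
    and eq: "Mexp p (Memb p (1 + ratfun_map of_rat (T ratfun_var) * ratfun_const \<zeta>)) (eps_omega p \<zeta>)
        = Mexp p (Memb p (1 + ratfun_var * ratfun_const (\<zeta> powi l))) (eps_omega p \<zeta>)
            \<otimes>\<^bsub>Mmod p\<^esub> Memb p (ratfun_const (\<zeta> powi m))
            \<otimes>\<^bsub>Mmod p\<^esub> u [^]\<^bsub>Mmod p\<^esub> p"
  shows "T = id \<or> T ratfun_var = inverse ratfun_var"
proof -
  interpret Z: cring "Zp p" using gt3 by (intro cring_Zp) simp
  interpret M: comm_group "Mmod p :: ((nat \<Rightarrow> int) \<times> 'k ratfun \<Rightarrow>\<^sub>0 int) set monoid"
    by (rule comm_group_tensor_group[OF Z.add.is_group group_ratfun_units])
  obtain a b c d where D: "[:d, c:] \<noteq> 0" and TY: "T ratfun_var = Fract [:b, a:] [:d, c:]"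
    by (rule field_aut_ratfun_moebius[OF T])
  define L where "L = nat (l mod int p)"
  have l_mod: "l mod int p = int L" "l mod int p \<noteq> 0" "l mod int p < int p"
    using l gt3 by (auto simp: L_def dvd_eq_mod_eq_0)
  then have L: "0 < L" "L < p" by auto
  have zL: "\<zeta> powi l = \<zeta> ^ L"
  proof -
    have "l = int p * (l div int p) + int L" using l_mod(1) by (metis mult_div_mod_eq)
    then have "\<zeta> powi l = (\<zeta> powi int p) powi (l div int p) * \<zeta> powi int L"
      using zeta_nonzero by (metis power_int_add power_int_mult)
    then show ?thesis by (simp add: zeta_power_p)
  qed
  define \<alpha> where "\<alpha> = - inverse (\<zeta> ^ L)"
  have \<alpha>: "\<alpha> * \<zeta> ^ L = - 1" using zeta_nonzero by (simp add: \<alpha>_def)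
  obtain \<psi> where \<psi>: "\<psi> \<in> hom (Mmod p) (integer_mod_group p)"
    and \<psi>_pure: "\<And>c r. c \<in> carrier (Zp p) \<Longrightarrow> r \<noteq> 0 \<Longrightarrow>
       \<psi> (pure_tensor (add_monoid (Zp p)) ratfun_units c r) = (c 1 * ratfun_order \<alpha> r) mod int p"
    using Mmod_order_char[of \<alpha>] by metis
  interpret \<psi>: group_hom "Mmod p" "integer_mod_group p" \<psi>
    by (intro group_hom.intro group_hom_axioms.intro M.is_group group_integer_mod_group \<psi>)

  \<comment> \<open>A conjugate of \<open>1 + Y \<zeta>\<^sup>l\<close> vanishes at \<open>\<alpha>\<close> only if \<open>s\<close> fixes \<open>\<zeta>\<^sup>l\<close>, which is a generator too.\<close>
  have rhs_set: "{s \<in> galQ. (of_rat 1 + of_rat 0 * \<alpha>) + (of_rat 0 + of_rat 1 * \<alpha>) * s (\<zeta> ^ L) = 0} = {id}"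
  proof (intro equalityI subsetI)
    fix s assume "s \<in> {s \<in> galQ. (of_rat 1 + of_rat 0 * \<alpha>) + (of_rat 0 + of_rat 1 * \<alpha>) * s (\<zeta> ^ L) = 0}"
    then have s: "s \<in> galQ" and "1 + \<alpha> * s (\<zeta> ^ L) = 0" by auto
    then have "\<alpha> * s (\<zeta> ^ L) = - 1" by (simp add: add_eq_0_iff)
    then have "\<alpha> * s (\<zeta> ^ L) = \<alpha> * \<zeta> ^ L" by (simp only: \<alpha>)
    moreover have "\<alpha> \<noteq> 0" using zeta_nonzero by (simp add: \<alpha>_def)
    ultimately have "s (\<zeta> ^ L) = \<zeta> ^ L" by (metis mult_left_cancel)
    moreover obtain k where k: "s \<zeta> = \<zeta> ^ k" by (rule galQ_zeta[OF s])
    ultimately have "\<zeta> ^ (k * L) = \<zeta> ^ (1 * L)"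
      by (simp add: field_aut_simps[OF galQ_field_aut[OF s]] power_mult)
    then have "[k * L = 1 * L] (mod p)" by (simp only: zeta_power_eq_iff)
    moreover have "coprime L p"
      using L prime by (metis coprime_commute nat_dvd_not_less prime_imp_coprime)
    ultimately have "[k = 1] (mod p)" by (metis cong_mult_rcancel_nat)
    then have "s \<zeta> = id \<zeta>" using zeta_power_eq_iff[of k 1] k by simp
    then show "s \<in> {id}" using galQ_eqI[OF s id_in_galQ] by simp
  qed (use \<alpha> id_in_galQ in auto)
  have Y: "ratfun_var = (ratfun_map of_rat (Fract [:0, 1:] [:1, 0:]) :: 'k ratfun)"
    by (subst ratfun_map_Fract) (auto simp: of_rat_add of_rat_mult map_poly_pCons ratfun_var_def one_pCons)
  define R where "R = Mexp p (Memb p (1 + ratfun_var * ratfun_const (\<zeta> ^ L))) (eps_omega p \<zeta>)"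
  have R: "R \<in> carrier (Mmod p)" "\<psi> R = eps_omega p \<zeta> id 1 mod int p"
    using order_char_moebius[OF \<psi> \<psi>_pure, of 1 0 0 "\<zeta> ^ L" 1] zeta_nonzero
    unfolding R_def Y rhs_set by simp_all
  define C :: "((nat \<Rightarrow> int) \<times> 'k ratfun \<Rightarrow>\<^sub>0 int) set" where "C = Memb p (ratfun_const (\<zeta> powi m))"
  have const: "ratfun_const (\<zeta> powi m) \<noteq> 0"
    using zeta_nonzero by (simp add: ratfun_const_to_fract power_int_eq_0_iff)
  have "ratfun_order \<alpha> (ratfun_const (\<zeta> powi m)) = 0"
    unfolding ratfun_const_def using zeta_nonzero
    by (subst ratfun_order_Fract) (auto simp: order_0I power_int_eq_0_iff)
  then have "\<psi> C = 0" unfolding C_def using \<psi>_pure[OF Z.one_closed const] by simp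
  moreover have "C \<in> carrier (Mmod p)"
    unfolding C_def using const by (intro pure_tensor_closed) (auto simp: ratfun_units_def)
  ultimately have C: "C \<in> carrier (Mmod p)" "\<psi> C = 0" by auto
  have up: "u [^]\<^bsub>Mmod p\<^esub> p \<in> carrier (Mmod p)" "\<psi> (u [^]\<^bsub>Mmod p\<^esub> p) = 0"
  proof -
    show "u [^]\<^bsub>Mmod p\<^esub> p \<in> carrier (Mmod p)" by (rule M.nat_pow_closed[OF u])
    show "\<psi> (u [^]\<^bsub>Mmod p\<^esub> p) = 0" using \<psi>.hom_nat_pow[OF u, of p] by simp
  qed
  have "\<psi> (R \<otimes>\<^bsub>Mmod p\<^esub> C \<otimes>\<^bsub>Mmod p\<^esub> u [^]\<^bsub>Mmod p\<^esub> p) = eps_omega p \<zeta> id 1 mod int p"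
    by (simp only: \<psi>.hom_mult[OF M.m_closed[OF R(1) C(1)] up(1)] \<psi>.hom_mult[OF R(1) C(1)] R(2) C(2) up(2)
        mult_integer_mod_group) simp
  then have \<psi>_eq: "\<psi> (Mexp p (Memb p (1 + ratfun_map of_rat (Fract [:b, a:] [:d, c:]) * ratfun_const \<zeta>))
      (eps_omega p \<zeta>)) = eps_omega p \<zeta> id 1 mod int p"
    using eq unfolding TY R_def C_def zL by metis

  \<comment> \<open>\<open>\<alpha>\<close> is irrational, so it is neither a pole of \<open>T(Y)\<close> nor of any conjugate of \<open>1 + T(Y) \<zeta>\<close>.\<close>
  have D\<alpha>: "of_rat d + of_rat c * \<alpha> \<noteq> 0"
  proof
    assume "of_rat d + of_rat c * \<alpha> = 0"
    then have "(of_rat d + of_rat c * \<alpha>) * \<zeta> ^ L = 0" by simp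
    then have "of_rat d * \<zeta> ^ L = of_rat c" using \<alpha> by (simp add: distrib_right mult.assoc)
    then show False using rational_power_relation[OF L] D by auto
  qed
  have N: "of_rat d + of_rat b * \<zeta> \<noteq> 0 \<or> of_rat c + of_rat a * \<zeta> \<noteq> 0"
  proof (rule ccontr)
    assume "\<not> ?thesis"
    then have "of_rat b * \<zeta> ^ 1 = of_rat (- d)" "of_rat a * \<zeta> ^ 1 = of_rat (- c)"
      by (simp_all add: of_rat_minus add_eq_0_iff)
    then show False using rational_power_relation[of 1 b "- d"] rational_power_relation[of 1 a "- c"] gt3 D
      by auto
  qed
  let ?S = "{s \<in> galQ. (of_rat d + of_rat c * \<alpha>) + (of_rat b + of_rat a * \<alpha>) * s \<zeta> = 0}"
  have sum: "(\<Sum>s\<in>?S. eps_omega p \<zeta> s 1) mod int p = eps_omega p \<zeta> id 1 mod int p"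
    using \<psi>_eq order_char_moebius(2)[OF \<psi> \<psi>_pure D D\<alpha> N] by metis
  have "id \<in> ?S"
  proof (cases "?S = {}")
    case True
    \<comment> \<open>Impossible: the right-hand side has order \<open>- 1\<close> modulo \<open>p\<close>, not 0.\<close>
    have "[eps_omega p \<zeta> id 1 * int 1 = - 1] (mod int p)"
      by (rule eps_omega_residue(2)[OF id_in_galQ]) simp
    moreover have "[eps_omega p \<zeta> id 1 = 0] (mod int p)"
      using sum unfolding True by (simp add: cong_def)
    ultimately have "[0 = - 1] (mod int p)" by (simp add: cong_def)
    then show ?thesis using gt3 by (simp add: cong_iff_dvd_diff)
  next
    case False
    then obtain s where s: "s \<in> ?S" by blast
    \<comment> \<open>The equation defining \<open>?S\<close> is linear in \<open>s \<zeta>\<close>, and \<open>s \<zeta>\<close> determines \<open>s\<close>.\<close>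
    have "t = s" if t: "t \<in> ?S" for t
    proof -
      have "(of_rat b + of_rat a * \<alpha>) * t \<zeta> = (of_rat b + of_rat a * \<alpha>) * s \<zeta>"
        using s t by (simp add: add_eq_0_iff2)
      moreover have "of_rat b + of_rat a * \<alpha> \<noteq> 0" using s D\<alpha> by auto
      ultimately show ?thesis using galQ_eqI[of t s] s t by auto
    qed
    then have "?S = {s}" using s by blast
    then have "[eps_omega p \<zeta> s 1 = eps_omega p \<zeta> id 1] (mod int p)"
      using sum by (simp add: cong_def)
    then have "s = id" using eps_omega_residue_inj id_in_galQ s by blast
    then show ?thesis using s by simp
  qed
  then have "((of_rat d + of_rat c * \<alpha>) + (of_rat b + of_rat a * \<alpha>) * \<zeta>) * \<zeta> ^ L = 0" by simp
  moreover have "((of_rat d + of_rat c * \<alpha>) + (of_rat b + of_rat a * \<alpha>) * \<zeta>) * \<zeta> ^ L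
      = of_rat d * \<zeta> ^ L + of_rat b * \<zeta> ^ Suc L + (of_rat c + of_rat a * \<zeta>) * (\<alpha> * \<zeta> ^ L)"
    by (simp add: algebra_simps)
  ultimately have "of_rat d * \<zeta> ^ L + of_rat b * \<zeta> ^ Suc L = of_rat c + of_rat a * \<zeta>"
    by (simp only: \<alpha> mult_minus1_right add_uminus_conv_diff right_minus_eq)
  then consider "c = 0" "d = 0" | "b = 0" "c = 0" "a = d" | "a = 0" "d = 0" "b = c"
    using four_term_relation[OF prime gt3 primitive L] by blast
  then show ?thesis
  proof cases
    case 1
    then show ?thesis using D by simp
  next
    case 2
    then have "T ratfun_var = ratfun_var"
      using D unfolding TY by (simp add: ratfun_var_def eq_fract)
    then show ?thesis using field_aut_eq_id[OF T] by simp
  next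
    case 3
    then have "T ratfun_var = inverse ratfun_var"
      using D unfolding TY by (simp add: ratfun_var_def eq_fract)
    then show ?thesis ..
  qed
qed

end

theorem theorem8:
  fixes p :: nat and \<zeta> :: "'k::field_char_0"
  assumes "prime p" and "p > 3"
    and "primitive_root_of_unity p \<zeta>"
    and "rat_adjoin \<zeta> = (UNIV :: 'k set)"
  shows "\<not> (\<exists>T :: rat ratfun \<Rightarrow> rat ratfun.
    field_aut T \<and> T \<noteq> id \<and> T ratfun_var \<noteq> inverse ratfun_var \<and>
    (\<exists>(l::int) (m::int). \<not> int p dvd l \<and>
      (\<exists>u \<in> carrier (Mmod p :: ((nat \<Rightarrow> int) \<times> 'k ratfun \<Rightarrow>\<^sub>0 int) set monoid).
        Mexp p (Memb p (1 + ratfun_map of_rat (T ratfun_var) * ratfun_const \<zeta>)) (eps_omega p \<zeta>)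
        = Mexp p (Memb p (1 + ratfun_var * ratfun_const (\<zeta> powi l))) (eps_omega p \<zeta>)
            \<otimes>\<^bsub>Mmod p\<^esub> Memb p (ratfun_const (\<zeta> powi m))
            \<otimes>\<^bsub>Mmod p\<^esub> u [^]\<^bsub>Mmod p\<^esub> p)))"
proof -
  interpret cyclotomic_field p \<zeta> by (rule cyclotomic_field.intro) (fact assms)+
  show ?thesis using only_trivial_twists by blast
qed

end
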